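(* Let $n\ge1$, $0<p_2\le p_1<\infty$ and $0<q_1,q_2<\infty$. Let $v_1,v_2$ be weights on $\mathbb{R}^n$, and let $w_1,w_2$ be weights on $(0,\infty)$ such that $\int_0^tw_1(s)^{q_1}ds<\infty$ and $\int_t^\infty w_2(s)^{q_2}ds<\infty$ for some $t>0$. Define, for $t>0$, $$\varphi(t)=\begin{cases}\displaystyle\Big(\int_{S^{n-1}}\big[v_1(ts')^{-1}v_2(ts')\big]^{\frac{p_1p_2}{p_1-p_2}}d\sigma(s')\Big)^{\frac{p_1-p_2}{p_1}}t^{\frac{(n-1)(p_1-p_2)}{p_1}},&\text{if }p_2<p_1,\\[1ex]\displaystyle\operatorname*{ess\,sup}_{s'\in S^{n-1}}\big[v_1(ts')^{-1}v_2(ts')\big]^{p_1},&\text{if }p_2=p_1.\end{cases}$$ Then the following two statements are equivalent. (i) There exists a constant $C>0$ such that $$\Big(\int_0^\infty\Big(\int_{B(0,t)}f(x)^{p_2}v_2(x)^{p_2}dx\Big)^{\frac{q_2}{p_2}}w_2(t)^{q_2}dt\Big)^{\frac1{q_2}}\le C\Big(\int_0^\infty\Big(\int_{\mathbb{R}^n\setminus B(0,t)}f(x)^{p_1}v_1(x)^{p_1}dx\Big)^{\frac{q_1}{p_1}}w_1(t)^{q_1}dt\Big)^{\frac1{q_1}}$$ holds for every nonnegative measurable function $f$ on $\mathbb{R}^n$. (ii) There exists a constant $\mathcal C>0$ such that $$\Big(\int_0^\infty\Big(\int_0^tg(s)^{p_2}\varphi(s)\,ds\Big)^{\frac{q_2}{p_2}}w_2(t)^{q_2}dt\Big)^{\frac1{q_2}}\le\mathcal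 C\Big(\int_0^\infty\Big(\int_t^\infty g(s)^{p_1}ds\Big)^{\frac{q_1}{p_1}}w_1(t)^{q_1}dt\Big)^{\frac1{q_1}}$$ holds for every nonnegative measurable function $g$ on $(0,\infty)$. Moreover, the best constants $C$ in (i) and $\mathcal C$ in (ii) satisfy $C=\mathcal C$.
   Context: A weight on a measurable set $A$ is a measurable function on $A$ that is positive and finite almost everywhere. $B(0,t)$ is the open ball in $\mathbb{R}^n$ centered at the origin with radius $t$. $S^{n-1}$ is the unit sphere of $\mathbb{R}^n$, and $\sigma$ is the unique Borel measure on $S^{n-1}$ such that $\int_{\mathbb{R}^n}f(x)\,dx=\int_0^\infty\big(\int_{S^{n-1}}f(rx')\,d\sigma(x')\big)r^{n-1}dr$ for every Borel measurable $f:\mathbb{R}^n\to\mathbb{R}$ that is nonnegative or integrable; the essential supremum over $S^{n-1}$ is with respect to $\sigma$. *)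

theory Defs
  imports "HOL-Analysis.Analysis" "HOL-Probability.Essential_Supremum"
begin

text \<open>
  Measurable means Lebesgue measurable, and nonnegative measurable functions take values in
  \<open>[0, \<infinity>]\<close>, i.e. in \<^typ>\<open>ennreal\<close>, with the usual convention \<open>0 * \<infinity> = 0\<close>.
  Functions on a set \<open>A\<close> are total functions of which only the values on \<open>A\<close> matter.
\<close>

text \<open>
  Powers of extended nonnegative reals with real exponent. Only exponents \<open>p > 0\<close>
  are used below; then \<open>0\<close> and \<open>\<infinity>\<close> are mapped to themselves.
\<close>

definition epowr :: "ennreal \<Rightarrow> real \<Rightarrow> ennreal" (infixr "epowr" 80) where
  "x epowr p = (if x = \<infinity> then \<infinity> else ennreal (enn2real x powr p))"

definition weight_on :: "'a::euclidean_space set \<Rightarrow> ('a \<Rightarrow> ennreal) \<Rightarrow> bool" where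
  "weight_on A v \<longleftrightarrow>
     v \<in> borel_measurable (lebesgue_on A) \<and>
     (AE x in lebesgue_on A. 0 < v x \<and> v x < \<infinity>)"

definition polar_measure :: "(real ^ 'n) measure \<Rightarrow> bool" where
  "polar_measure M \<longleftrightarrow>
     space M = sphere 0 1 \<and>
     sets M = sets (restrict_space borel (sphere 0 1)) \<and>
     (\<forall>f :: real ^ 'n \<Rightarrow> real. f \<in> borel_measurable borel \<longrightarrow> (\<forall>x. 0 \<le> f x) \<longrightarrow>
        (\<integral>\<^sup>+x. ennreal (f x) \<partial>lborel) =
        (\<integral>\<^sup>+r\<in>{0<..}. (\<integral>\<^sup>+s. ennreal (f (r *\<^sub>R s)) \<partial>M) * ennreal (r ^ (CARD('n) - 1)) \<partial>lborel)) \<and>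
     (\<forall>f :: real ^ 'n \<Rightarrow> real. f \<in> borel_measurable borel \<longrightarrow> integrable lborel f \<longrightarrow>
        (\<integral>x. f x \<partial>lborel) =
        (LINT r:{0<..}|lborel. (\<integral>s. f (r *\<^sub>R s) \<partial>M) * r ^ (CARD('n) - 1)))"

definition sphere_measure :: "(real ^ 'n) measure" where
  "sphere_measure = (THE M. polar_measure M)"

text \<open>
  The completion of \<^const>\<open>sphere_measure\<close> is needed because, for Lebesgue measurable \<open>v\<^sub>1\<close>, \<open>v\<^sub>2\<close>,
  the restriction to almost every sphere is only measurable with respect to the completion,
  and \<^const>\<open>esssup\<close> takes the value \<open>\<infinity>\<close> on functions that are not measurable.
\<close>

definition phi :: "real \<Rightarrow> real \<Rightarrow> (real ^ 'n \<Rightarrow> ennreal) \<Rightarrow> (real ^ 'n \<Rightarrow> ennreal) \<Rightarrow> real \<Rightarrow> ennreal" where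
  "phi p1 p2 v1 v2 t =
     (if p2 < p1 then
        (\<integral>\<^sup>+s. (inverse (v1 (t *\<^sub>R s)) * v2 (t *\<^sub>R s)) epowr (p1 * p2 / (p1 - p2))
           \<partial>completion sphere_measure) epowr ((p1 - p2) / p1)
        * ennreal (t powr ((real CARD('n) - 1) * (p1 - p2) / p1))
      else
        esssup (completion sphere_measure)
          (\<lambda>s. (inverse (v1 (t *\<^sub>R s)) * v2 (t *\<^sub>R s)) epowr p1))"

definition ineq_Rn ::
  "real \<Rightarrow> real \<Rightarrow> real \<Rightarrow> real \<Rightarrow> (real ^ 'n \<Rightarrow> ennreal) \<Rightarrow> (real ^ 'n \<Rightarrow> ennreal) \<Rightarrow>
   (real \<Rightarrow> ennreal) \<Rightarrow> (real \<Rightarrow> ennreal) \<Rightarrow> real \<Rightarrow> bool" where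
  "ineq_Rn p1 p2 q1 q2 v1 v2 w1 w2 C \<longleftrightarrow>
     (\<forall>f :: real ^ 'n \<Rightarrow> ennreal. f \<in> borel_measurable lebesgue \<longrightarrow>
        (\<integral>\<^sup>+t. (\<integral>\<^sup>+x. f x epowr p2 * v2 x epowr p2 \<partial>lebesgue_on (ball 0 t)) epowr (q2 / p2)
              * w2 t epowr q2 \<partial>lebesgue_on {0<..}) epowr (1 / q2)
        \<le> ennreal C *
        (\<integral>\<^sup>+t. (\<integral>\<^sup>+x. f x epowr p1 * v1 x epowr p1 \<partial>lebesgue_on (UNIV - ball 0 t)) epowr (q1 / p1)
              * w1 t epowr q1 \<partial>lebesgue_on {0<..}) epowr (1 / q1))"

definition ineq_halfline ::
  "real \<Rightarrow> real \<Rightarrow> real \<Rightarrow> real \<Rightarrow> (real \<Rightarrow> ennreal) \<Rightarrow>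
   (real \<Rightarrow> ennreal) \<Rightarrow> (real \<Rightarrow> ennreal) \<Rightarrow> real \<Rightarrow> bool" where
  "ineq_halfline p1 p2 q1 q2 \<phi> w1 w2 C \<longleftrightarrow>
     (\<forall>g :: real \<Rightarrow> ennreal. g \<in> borel_measurable (lebesgue_on {0<..}) \<longrightarrow>
        (\<integral>\<^sup>+t. (\<integral>\<^sup>+s. g s epowr p2 * \<phi> s \<partial>lebesgue_on {0<..<t}) epowr (q2 / p2)
              * w2 t epowr q2 \<partial>lebesgue_on {0<..}) epowr (1 / q2)
        \<le> ennreal C *
        (\<integral>\<^sup>+t. (\<integral>\<^sup>+s. g s epowr p1 \<partial>lebesgue_on {t<..}) epowr (q1 / p1)
              * w1 t epowr q1 \<partial>lebesgue_on {0<..}) epowr (1 / q1))"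

text \<open>The value is \<open>\<infinity>\<close> if no positive real constant is admissible.\<close>

definition best_constant :: "(real \<Rightarrow> bool) \<Rightarrow> ennreal" where
  "best_constant P = Inf (ennreal ` {C. 0 < C \<and> P C})"

end

theory Submission
  imports Defs
begin

text \<open>
  Both inequalities concern only how the mass of a function is distributed over the spheres centred at
  the origin. For \<open>i = 1, 2\<close> let \<open>S\<^sub>i f(s)\<close> be the integral of the \<open>p\<^sub>i\<close>-th power of \<open>f v\<^sub>i\<close> over the sphere of
  radius \<open>s\<close>. By polar coordinates, the integral over \<open>B(0, t)\<close> on the left of the inequality for \<open>f\<close> is
  \<open>\<integral>\<^sub>0\<^sup>t S\<^sub>2 f(s) ds\<close>, and the integral over the complement on the right is \<open>\<integral>\<^sub>t\<^sup>\<infinity> S\<^sub>1 f(s) ds\<close>. What links the two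
  is Hoelder's inequality on each sphere, \<open>S\<^sub>2 f(s) \<le> \<phi>(s) (S\<^sub>1 f(s)) powr (p\<^sub>2 / p\<^sub>1)\<close>, with \<open>\<phi>\<close> as its
  sharp constant.

  If the inequality on the half-line holds with a constant \<open>C\<close>, then applying it to the function \<open>g\<close> whose
  \<open>p\<^sub>1\<close>-th power is \<open>S\<^sub>1 f\<close> gives the inequality for \<open>f\<close> with the same \<open>C\<close> (\<open>shell_holder\<close>).
  Conversely, sharpness of Hoelder's inequality (\<open>extremal_family\<close>) yields functions \<open>F\<^sub>k\<close> with
  \<open>S\<^sub>1 F\<^sub>k \<le> 1\<close> and \<open>S\<^sub>2 F\<^sub>k \<ge> c\<^sub>k\<close>, where \<open>c\<^sub>k\<close> increases to \<open>\<phi>\<close>. Testing with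
  \<open>f(x) = g(\<bar>x\<bar>) F\<^sub>k(x)\<close> gives the inequality on the half-line with \<open>c\<^sub>k\<close> in place of \<open>\<phi>\<close>, and monotone
  convergence gives it with \<open>\<phi>\<close>. The approximation by \<open>c\<^sub>k\<close> is what makes the argument work where
  \<open>\<phi>\<close> is infinite, and where \<open>\<phi>\<close> is an essential supremum that no function attains.

  The two inequalities are therefore equivalent for each individual constant, which is more than
  equality of the best constants.

  Two preparations are needed. The measure on the sphere, introduced by a definite description, has to be
  shown to exist and to be unique; it is constructed from the Lebesgue measure of sectors of the ball.
  And \<open>v\<^sub>1\<close>, \<open>v\<^sub>2\<close>, \<open>f\<close> and \<open>g\<close> are replaced by Borel functions equal to them almost everywhere, because a Lebesgue
  measurable function need not have measurable restrictions to spheres; by Tonelli's theorem the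
  exceptional null set meets almost every sphere in a null set, so \<open>\<phi>\<close> changes only on a null set of
  radii.
\<close>

section \<open>Powers of extended nonnegative reals\<close>

lemma epowr_top [simp]: "top epowr p = top"
  by (simp add: epowr_def)

lemma epowr_ennreal: "0 \<le> x \<Longrightarrow> ennreal x epowr p = ennreal (x powr p)"
  by (simp add: epowr_def)

lemma epowr_zero [simp]: "0 epowr p = 0"
  by (simp add: epowr_def)

lemma epowr_one [simp]: "x epowr 1 = x"
  by (cases x) (auto simp: epowr_def)

lemma epowr_mult: "0 < p \<Longrightarrow> (x * y) epowr p = x epowr p * y epowr p"
  by (cases x; cases y)
     (auto simp: epowr_ennreal ennreal_mult[symmetric] powr_mult ennreal_mult_top ennreal_top_mult)

lemma epowr_epowr: "(x epowr p) epowr q = x epowr (p * q)"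
  by (cases x) (auto simp: epowr_ennreal powr_powr)

lemma epowr_add: "0 < p \<Longrightarrow> 0 < q \<Longrightarrow> x epowr p * x epowr q = x epowr (p + q)"
  by (cases x) (auto simp: epowr_ennreal powr_add ennreal_mult ennreal_top_mult)

lemma epowr_mono: "0 < p \<Longrightarrow> x \<le> y \<Longrightarrow> x epowr p \<le> y epowr p"
  by (cases x; cases y)
     (auto simp: epowr_ennreal top_unique powr_mono2 ennreal_le_iff)

lemma epowr_eq_0_iff: "x epowr p = 0 \<longleftrightarrow> x = 0"
  by (cases x) (auto simp: epowr_ennreal)

lemma epowr_inverse_mult:
  assumes "0 < p" "0 < x" "x < \<infinity>" shows "inverse x epowr p * x epowr p = 1"
proof -
  have "inverse x * x = 1"
    using assms by (metis ennreal_divide_self infinity_ennreal_def less_numeral_extra(3) divide_ennreal_def mult.commute top.not_eq_extremum)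
  then show ?thesis
    using epowr_mult[OF assms(1), of "inverse x" x] by (simp add: epowr_def)
qed

text \<open>
  For \<open>p > 0\<close> the map \<open>x \<mapsto> x epowr p\<close> is an order isomorphism with inverse \<open>x \<mapsto> x epowr (1 / p)\<close>, and order
  isomorphisms preserve suprema.
\<close>

lemma epowr_SUP:
  fixes f :: "'i \<Rightarrow> ennreal"
  assumes "0 < p"
  shows "(SUP i\<in>I. f i) epowr p = (SUP i\<in>I. f i epowr p)"
proof (rule antisym)
  let ?S = "SUP i\<in>I. f i epowr p"
  have "f i \<le> ?S epowr (1 / p)" if "i \<in> I" for i
  proof -
    have "f i = (f i epowr p) epowr (1 / p)"
      using assms by (simp add: epowr_epowr)
    also have "\<dots> \<le> ?S epowr (1 / p)"
      using assms that by (intro epowr_mono SUP_upper) auto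
    finally show ?thesis .
  qed
  then have "(SUP i\<in>I. f i) \<le> ?S epowr (1 / p)"
    by (intro SUP_least)
  then have "(SUP i\<in>I. f i) epowr p \<le> (?S epowr (1 / p)) epowr p"
    using assms by (intro epowr_mono)
  then show "(SUP i\<in>I. f i) epowr p \<le> ?S"
    using assms by (simp add: epowr_epowr)
qed (use assms in \<open>auto intro!: SUP_least epowr_mono SUP_upper\<close>)

lemma borel_measurable_epowr [measurable]:
  assumes [measurable]: "f \<in> borel_measurable M"
  shows "(\<lambda>x. f x epowr p) \<in> borel_measurable M"
  unfolding epowr_def by measurable

text \<open>
  Young's inequality for \<open>x / A\<close> and \<open>y / B\<close>. In Hoelder's inequality below, \<open>A\<close> and \<open>B\<close> are the
  integrals of the two factors, so that the right-hand side integrates to \<open>A epowr a * B epowr (1 - a)\<close>.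
\<close>

lemma young_epowr:
  assumes "0 < a" "a < 1" "0 < A" "A < \<infinity>" "0 < B" "B < \<infinity>"
  shows "x epowr a * y epowr (1 - a)
    \<le> A epowr a * B epowr (1 - a) * (ennreal a * (x * inverse A) + ennreal (1 - a) * (y * inverse B))"
proof -
  have top: "A epowr a * B epowr (1 - a) \<noteq> 0" "inverse A \<noteq> 0" "inverse B \<noteq> 0"
    using assms by (auto simp: epowr_eq_0_iff)
  show ?thesis
  proof (cases "x = \<infinity> \<or> y = \<infinity>")
    case True
    then show ?thesis
      using top assms by (auto simp: ennreal_mult_top ennreal_top_mult)
  next
    case False
    then obtain x' y' A' B' where
      eq: "x = ennreal x'" "y = ennreal y'" "A = ennreal A'" "B = ennreal B'"
      and pos: "0 \<le> x'" "0 \<le> y'" "0 < A'" "0 < B'"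
      using assms by (cases x; cases y; cases A; cases B) auto
    have "x' powr a * y' powr (1 - a)
      \<le> A' powr a * B' powr (1 - a) * (a * (x' * inverse A') + (1 - a) * (y' * inverse B'))"
    proof (cases "x' = 0 \<or> y' = 0")
      case True
      then show ?thesis using pos assms by auto
    next
      case False
      have young: "(x' / A') powr a * (y' / B') powr (1 - a) \<le> a * (x' / A') + (1 - a) * (y' / B')"
        using False pos assms by (intro Youngs_inequality_0) auto
      have "x' powr a = A' powr a * (x' / A') powr a"
        "y' powr (1 - a) = B' powr (1 - a) * (y' / B') powr (1 - a)"
        using False pos by (auto simp: powr_mult[symmetric])
      then have "x' powr a * y' powr (1 - a)
          = A' powr a * B' powr (1 - a) * ((x' / A') powr a * (y' / B') powr (1 - a))"
        by simp
      also have "\<dots> \<le> A' powr a * B' powr (1 - a) * (a * (x' / A') + (1 - a) * (y' / B'))"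
        using young by (intro mult_left_mono) auto
      finally show ?thesis by (simp add: divide_inverse)
    qed
    then show ?thesis
      using pos assms
      by (simp add: eq epowr_ennreal inverse_ennreal ennreal_mult[symmetric] ennreal_plus[symmetric] del: ennreal_plus)
  qed
qed

lemma holder_epowr:
  assumes a: "0 < a" "a < 1"
    and [measurable]: "X \<in> borel_measurable M" "Y \<in> borel_measurable M"
  shows "(\<integral>\<^sup>+x. X x epowr a * Y x epowr (1 - a) \<partial>M)
    \<le> (\<integral>\<^sup>+x. X x \<partial>M) epowr a * (\<integral>\<^sup>+x. Y x \<partial>M) epowr (1 - a)"
proof -
  define A where "A = (\<integral>\<^sup>+x. X x \<partial>M)"
  define B where "B = (\<integral>\<^sup>+x. Y x \<partial>M)"
  have zero: ?thesis if "A = 0 \<or> B = 0"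
  proof -
    from that have "AE x in M. X x epowr a * Y x epowr (1 - a) = 0"
      unfolding A_def B_def by (auto simp: nn_integral_0_iff_AE)
    then have "(\<integral>\<^sup>+x. X x epowr a * Y x epowr (1 - a) \<partial>M) = 0"
      by (subst nn_integral_0_iff_AE) auto
    then show ?thesis by simp
  qed
  show ?thesis
  proof (cases "A = 0 \<or> B = 0")
    case True
    then show ?thesis by (rule zero)
  next
    case False
    show ?thesis
    proof (cases "A = \<infinity> \<or> B = \<infinity>")
      case True
      then show ?thesis
        using False unfolding A_def[symmetric] B_def[symmetric]
        by (auto simp: epowr_eq_0_iff ennreal_mult_top ennreal_top_mult)
    next
      case fin: False
      have AB: "0 < A" "A < \<infinity>" "0 < B" "B < \<infinity>"
        using False fin by (auto simp: zero_less_iff_neq_zero less_top)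
      have one: "A * inverse A = 1" "B * inverse B = 1"
        using False fin by (auto simp: divide_ennreal_def[symmetric] intro!: ennreal_divide_self simp: less_top)
      have "(\<integral>\<^sup>+x. X x epowr a * Y x epowr (1 - a) \<partial>M)
        \<le> (\<integral>\<^sup>+x. A epowr a * B epowr (1 - a) * (ennreal a * (X x * inverse A) + ennreal (1 - a) * (Y x * inverse B)) \<partial>M)"
        by (intro nn_integral_mono young_epowr a AB)
      also have "\<dots> = A epowr a * B epowr (1 - a) * (ennreal a * (A * inverse A) + ennreal (1 - a) * (B * inverse B))"
        by (simp add: nn_integral_cmult nn_integral_multc nn_integral_add A_def B_def)
      also have "\<dots> = A epowr a * B epowr (1 - a)"
        using a by (simp add: one ennreal_plus[symmetric] del: ennreal_plus)
      finally show ?thesis by (simp add: A_def B_def)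
    qed
  qed
qed

section \<open>Polar coordinates and the surface measure of the sphere\<close>

text \<open>
  The mass of \<open>A\<close> is \<open>n\<close> times the volume of the sector of the unit ball over \<open>A\<close>. The factor is forced
  by polar coordinates: the sector has volume \<open>\<sigma>(A)\<close> times the integral of \<open>r\<close> to the power \<open>n - 1\<close> over
  \<open>(0, 1)\<close>, which is \<open>1 / n\<close>.
\<close>

definition surface_measure :: "(real ^ 'n) measure" where
  "surface_measure = scale_measure (of_nat CARD('n))
     (distr (restrict_space lborel (ball 0 1 - {0})) (restrict_space borel (sphere 0 1))
        (\<lambda>x. x /\<^sub>R norm x))"

definition radial_measure :: "nat \<Rightarrow> real measure" where
  "radial_measure n = density lborel (\<lambda>r. ennreal (r ^ (n - 1) * indicator {0<..} r))"

lemma space_surface_measure [simp]: "space surface_measure = sphere 0 1"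
  by (simp add: surface_measure_def space_scale_measure space_restrict_space)

lemma sets_surface_measure [measurable_cong]:
  "sets surface_measure = sets (restrict_space borel (sphere 0 1))"
  by (simp add: surface_measure_def)

lemma in_sets_surface_measure_iff:
  "A \<in> sets surface_measure \<longleftrightarrow> A \<in> sets borel \<and> A \<subseteq> sphere 0 1"
  by (subst sets_surface_measure, subst sets_restrict_space_iff) auto

lemma measurable_ident_surface_measure [measurable]: "(\<lambda>x. x) \<in> surface_measure \<rightarrow>\<^sub>M borel"
  using measurable_restrict_space1[OF measurable_ident] unfolding id_def
  by (subst measurable_cong_sets[OF sets_surface_measure refl]) auto

lemma measurable_direction:
  "(\<lambda>x::real^'n. x /\<^sub>R norm x) \<in> restrict_space lborel (S - {0}) \<rightarrow>\<^sub>M restrict_space borel (sphere 0 1)"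
  by (intro measurable_restrict_space2 measurable_restrict_space1)
     (auto simp: space_restrict_space)

text \<open>
  A set \<open>A\<close> of unit vectors does not contain \<open>0 /\<^sub>R norm 0 = 0\<close>, so its sectors omit the origin.
\<close>

definition sector :: "real \<Rightarrow> (real ^ 'n) set \<Rightarrow> (real ^ 'n) set" where
  "sector r A = {x. norm x < r \<and> x /\<^sub>R norm x \<in> A}"

lemma sector_borel:
  assumes [measurable]: "A \<in> sets borel" shows "sector r A \<in> sets borel"
  unfolding sector_def by measurable

lemma emeasure_surface_measure:
  fixes A :: "(real ^ 'n) set"
  assumes "A \<in> sets surface_measure"
  shows "emeasure surface_measure A = of_nat CARD('n) * emeasure lborel (sector 1 A)"
proof -
  have A: "A \<in> sets borel" "A \<subseteq> sphere 0 1"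
    using assms by (auto simp: in_sets_surface_measure_iff)
  have eq: "(\<lambda>x. x /\<^sub>R norm x) -` A \<inter> space (restrict_space lborel (ball 0 1 - {0})) = sector 1 A"
    using A(2) by (auto simp: sector_def space_restrict_space)
  have sub: "sector 1 A \<subseteq> ball 0 1 - {0}"
    using A(2) by (auto simp: sector_def)
  have "A \<in> sets (restrict_space borel (sphere 0 1))"
    using assms by (simp add: sets_surface_measure)
  then have "emeasure (distr (restrict_space lborel (ball 0 1 - {0})) (restrict_space borel (sphere 0 1)) (\<lambda>x. x /\<^sub>R norm x)) A
      = emeasure (restrict_space lborel (ball 0 1 - {0})) (sector 1 A)"
    by (subst emeasure_distr[OF measurable_direction], assumption, simp only: eq)
  also have "\<dots> = emeasure lborel (sector 1 A)"
    using sub by (subst emeasure_restrict_space) auto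
  finally show ?thesis
    by (simp add: surface_measure_def)
qed

text \<open>
  Dilation by \<open>r\<close> maps the sector of radius \<open>1\<close> onto the one of radius \<open>r\<close> and multiplies volumes by
  the \<open>n\<close>-th power of \<open>r\<close>.
\<close>

lemma emeasure_sector:
  fixes A :: "(real ^ 'n) set"
  assumes "0 < r" and [measurable]: "A \<in> sets borel"
  shows "emeasure lborel (sector r A) = ennreal (r ^ CARD('n)) * emeasure lborel (sector 1 A)"
proof -
  note [measurable] = sector_borel
  have vim: "(\<lambda>x. 0 + r *\<^sub>R x) -` sector r A = sector 1 A"
  proof -
    have "(r *\<^sub>R x) /\<^sub>R norm (r *\<^sub>R x) = x /\<^sub>R norm x" for x :: "real ^ 'n"
      using assms(1) by (cases "x = 0") auto
    then show ?thesis
      using assms(1) unfolding sector_def by (auto simp del: scaleR_scaleR)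
  qed
  have "emeasure lborel (sector r A)
      = emeasure (density (distr lborel borel (\<lambda>x. 0 + r *\<^sub>R x)) (\<lambda>_. \<bar>r\<bar> ^ DIM(real ^ 'n))) (sector r A)"
    using assms(1) by (subst lborel_affine[of r 0]) auto
  also have "\<dots> = \<bar>r\<bar> ^ DIM(real ^ 'n) * emeasure (distr lborel borel (\<lambda>x. 0 + r *\<^sub>R x)) (sector r A)"
    by (subst emeasure_density_const) auto
  also have "emeasure (distr lborel borel (\<lambda>x. 0 + r *\<^sub>R x)) (sector r A) = emeasure lborel (sector 1 A)"
    by (subst emeasure_distr) (auto simp: vim simp del: add_0)
  finally show ?thesis using assms(1) by (simp add: ennreal_power)
qed

lemma finite_surface_measure: "finite_measure (surface_measure :: (real ^ 'n) measure)"
proof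
  have "emeasure lborel (sector 1 (sphere 0 1) :: (real ^ 'n) set) \<le> emeasure lborel (ball 0 1 :: (real ^ 'n) set)"
    by (intro emeasure_mono) (auto simp: sector_def)
  also have "\<dots> < \<infinity>"
    by (rule emeasure_bounded_finite) auto
  finally show "emeasure (surface_measure :: (real ^ 'n) measure) (space surface_measure) \<noteq> \<infinity>"
    by (subst emeasure_surface_measure)
       (auto simp: in_sets_surface_measure_iff ennreal_mult_eq_top_iff)
qed

lemma emeasure_radial_measure:
  assumes "0 < n"
  shows "emeasure (radial_measure n) {..<a} = ennreal ((max 0 a) ^ n / n)"
proof -
  have "emeasure (radial_measure n) {..<a}
      = (\<integral>\<^sup>+r. ennreal (r ^ (n - 1) * indicator {0<..} r) * indicator {..<a} r \<partial>lborel)"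
    unfolding radial_measure_def by (subst emeasure_density) auto
  also have "\<dots> = (\<integral>\<^sup>+r. ennreal (r ^ (n - 1)) * indicator {0..max 0 a} r \<partial>lborel)"
    by (rule nn_integral_cong_AE, rule AE_mp[OF AE_conjI[OF AE_lborel_singleton[of 0] AE_lborel_singleton[of a]]],
        rule AE_I2) (auto split: split_indicator)
  also have "\<dots> = ennreal ((max 0 a) ^ n / n - 0 ^ n / n)"
    using assms by (intro nn_integral_FTC_Icc) (auto intro!: derivative_eq_intros)
  finally show ?thesis using assms by (simp add: zero_power)
qed

lemma sets_radial_measure [measurable_cong, simp]: "sets (radial_measure n) = sets borel"
  by (simp add: radial_measure_def)

lemma space_radial_measure [simp]: "space (radial_measure n) = UNIV"
  by (simp add: radial_measure_def)

text \<open>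
  For fixed \<open>B\<close>, both sides are measures in \<open>A\<close>. On the half-lines \<open>{..<a}\<close>, which generate the Borel
  sets, they agree because both scale like the \<open>n\<close>-th power of \<open>a\<close>, and the normalisation of the surface
  measure makes them equal at \<open>a = 1\<close>.
\<close>

lemma emeasure_radial_angular:
  fixes B :: "(real ^ 'n) set"
  assumes A: "A \<in> sets borel" and B: "B \<in> sets surface_measure"
  shows "emeasure lborel {x. norm x \<in> A \<and> x /\<^sub>R norm x \<in> B}
    = emeasure (radial_measure CARD('n)) A * emeasure surface_measure B"
proof -
  have [measurable]: "B \<in> sets borel" and Bs: "B \<subseteq> sphere 0 1"
    using B by (auto simp: in_sets_surface_measure_iff)
  let ?D = "{x. x /\<^sub>R norm x \<in> B}"
  define P where "P = distr (restrict_space lborel ?D) borel norm"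
  define Q where "Q = scale_measure (emeasure surface_measure B) (radial_measure CARD('n))"
  have [measurable]: "norm \<in> restrict_space lborel ?D \<rightarrow>\<^sub>M borel"
    by (intro measurable_restrict_space1) auto
  have P: "emeasure P A = emeasure lborel {x. norm x \<in> A \<and> x /\<^sub>R norm x \<in> B}" if [measurable]: "A \<in> sets borel" for A
  proof -
    have "emeasure P A = emeasure (restrict_space lborel ?D) {x. norm x \<in> A \<and> x /\<^sub>R norm x \<in> B}"
      unfolding P_def by (subst emeasure_distr) (auto simp: space_restrict_space intro!: arg_cong2[where f=emeasure])
    also have "\<dots> = emeasure lborel {x. norm x \<in> A \<and> x /\<^sub>R norm x \<in> B}"
      by (subst emeasure_restrict_space) auto
    finally show ?thesis .
  qed
  have halfline: "emeasure P {..<a} = ennreal (max 0 a ^ CARD('n)) * emeasure lborel (sector 1 B)" for a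
  proof (cases "0 < a")
    case True
    have "emeasure P {..<a} = emeasure lborel (sector a B)"
      by (subst P) (auto simp: sector_def)
    also have "\<dots> = ennreal (a ^ CARD('n)) * emeasure lborel (sector 1 B)"
      by (rule emeasure_sector[OF True]) simp
    finally show ?thesis using True by (simp add: max_def)
  next
    case False
    have "emeasure P {..<a} = emeasure lborel {x::real^'n. norm x < a \<and> x /\<^sub>R norm x \<in> B}"
      by (subst P) auto
    also have "{x::real^'n. norm x < a \<and> x /\<^sub>R norm x \<in> B} = {}"
    proof -
      have "\<not> norm x < a" for x :: "real ^ 'n"
        using False norm_ge_zero[of x] by linarith
      then show ?thesis by simp
    qed
    finally show ?thesis using False by (simp add: max_def)
  qed
  have Qhalf: "emeasure Q {..<a} = ennreal (max 0 a ^ CARD('n)) * emeasure lborel (sector 1 B)" for a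
  proof -
    have "emeasure Q {..<a} = ennreal (max 0 a ^ CARD('n) / CARD('n)) * (ennreal (real CARD('n)) * emeasure lborel (sector 1 B))"
      unfolding Q_def using B
      by (simp add: emeasure_radial_measure emeasure_surface_measure mult.commute ennreal_of_nat_eq_real_of_nat)
    also have "\<dots> = ennreal (max 0 a ^ CARD('n) / CARD('n) * CARD('n)) * emeasure lborel (sector 1 B)"
      by (subst mult.assoc[symmetric], subst ennreal_mult[symmetric]) auto
    finally show ?thesis by simp
  qed
  have fin: "emeasure lborel (sector 1 B) < \<infinity>"
  proof -
    have "emeasure lborel (sector 1 B) \<le> emeasure lborel (ball 0 1 :: (real ^ 'n) set)"
      by (intro emeasure_mono) (auto simp: sector_def)
    also have "\<dots> < \<infinity>"
      by (rule emeasure_bounded_finite) auto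
    finally show ?thesis .
  qed
  have "P = Q"
  proof (rule measure_eqI_generator_eq[where E="range lessThan" and \<Omega>=UNIV and A="\<lambda>i. {..<real i}"])
    show "Int_stable (range (lessThan :: real \<Rightarrow> _))"
    proof -
      have "{..<a} \<inter> {..<b} = {..<min a b}" for a b :: real by auto
      then show ?thesis by (auto simp: Int_stable_def)
    qed
    show "sets P = sigma_sets UNIV (range lessThan)" "sets Q = sigma_sets UNIV (range lessThan)"
      by (simp_all add: P_def Q_def borel_Iio)
    show "(\<Union>i. {..<real i}) = UNIV"
      by (auto intro: reals_Archimedean2)
    show "emeasure P {..<real i} \<noteq> \<infinity>" for i
      using fin by (simp add: halfline ennreal_mult_eq_top_iff)
  qed (auto simp: halfline Qhalf)
  then have "emeasure P A = emeasure Q A" by simp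
  then show ?thesis
    using A by (simp add: P Q_def mult.commute)
qed

lemma sigma_finite_radial_measure: "sigma_finite_measure (radial_measure n)"
  unfolding radial_measure_def
  by (subst sigma_finite_measure.sigma_finite_iff_density_finite[OF lborel.sigma_finite_measure_axioms]) auto

text \<open>
  In polar coordinates Lebesgue measure is a product measure; with Tonelli's and Fubini's theorems this
  gives the two integral formulas that characterise the surface measure.
\<close>

lemma polar_product:
  "radial_measure CARD('n) \<Otimes>\<^sub>M (surface_measure :: (real ^ 'n) measure)
    = distr (restrict_space lborel (- {0})) (borel \<Otimes>\<^sub>M surface_measure) (\<lambda>x. (norm x, x /\<^sub>R norm x))"
    (is "_ = distr ?R ?M ?T")
  and measurable_polar:
  "(\<lambda>x. (norm x, x /\<^sub>R norm x)) \<in> restrict_space lborel (- {0}) \<rightarrow>\<^sub>M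
     borel \<Otimes>\<^sub>M (surface_measure :: (real ^ 'n) measure)"
proof -
  have "(\<lambda>x. x /\<^sub>R norm x) \<in> ?R \<rightarrow>\<^sub>M surface_measure"
    using measurable_direction[of UNIV]
    by (subst measurable_cong_sets[OF refl sets_surface_measure]) (simp add: Compl_eq_Diff_UNIV)
  moreover have "norm \<in> ?R \<rightarrow>\<^sub>M borel"
    by (intro measurable_restrict_space1) auto
  ultimately show T: "?T \<in> ?R \<rightarrow>\<^sub>M ?M" by simp
  show "radial_measure CARD('n) \<Otimes>\<^sub>M surface_measure = distr ?R ?M ?T"
  proof (rule pair_measure_eqI)
    show "sigma_finite_measure (radial_measure CARD('n))"
      by (rule sigma_finite_radial_measure)
    show "sigma_finite_measure (surface_measure :: (real ^ 'n) measure)"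
      by (rule finite_measure.axioms(1)[OF finite_surface_measure])
    show "sets (radial_measure CARD('n) \<Otimes>\<^sub>M surface_measure) = sets (distr ?R ?M ?T)"
      by (simp add: cong: sets_pair_measure_cong)
    fix A and B :: "(real ^ 'n) set"
    assume A: "A \<in> sets (radial_measure CARD('n))" and B: "B \<in> sets surface_measure"
    have B': "B \<subseteq> sphere 0 1"
      using B by (simp add: in_sets_surface_measure_iff)
    have "emeasure (distr ?R ?M ?T) (A \<times> B) = emeasure ?R {x. norm x \<in> A \<and> x /\<^sub>R norm x \<in> B}"
      using A B B' by (subst emeasure_distr[OF T])
        (auto simp: space_restrict_space intro!: arg_cong2[where f=emeasure])
    also have "\<dots> = emeasure lborel {x. norm x \<in> A \<and> x /\<^sub>R norm x \<in> B}"
      using B' by (subst emeasure_restrict_space) auto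
    also have "\<dots> = emeasure (radial_measure CARD('n)) A * emeasure surface_measure B"
      using A B by (simp add: emeasure_radial_angular)
    finally show "emeasure (radial_measure CARD('n)) A * emeasure surface_measure B
        = emeasure (distr ?R ?M ?T) (A \<times> B)" ..
  qed
qed

lemma sigma_finite_surface_measure: "sigma_finite_measure surface_measure"
  by (rule finite_measure.axioms(1)[OF finite_surface_measure])

lemma measurable_scaleR_surface [measurable]:
  "(\<lambda>z. fst z *\<^sub>R snd z) \<in> borel \<Otimes>\<^sub>M (surface_measure :: (real ^ 'n) measure) \<rightarrow>\<^sub>M borel"
proof -
  have [measurable]: "snd \<in> borel \<Otimes>\<^sub>M (surface_measure :: (real ^ 'n) measure) \<rightarrow>\<^sub>M borel"
    using measurable_compose[OF measurable_snd measurable_ident_surface_measure] by simp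
  show ?thesis by measurable
qed

lemma nn_integral_polar_coordinates:
  fixes f :: "real ^ 'n \<Rightarrow> ennreal"
  assumes [measurable]: "f \<in> borel_measurable borel"
  shows "(\<integral>\<^sup>+x. f x \<partial>lborel)
    = (\<integral>\<^sup>+r\<in>{0<..}. (\<integral>\<^sup>+s. f (r *\<^sub>R s) \<partial>surface_measure) * ennreal (r ^ (CARD('n) - 1)) \<partial>lborel)"
proof -
  interpret sigma_finite_measure "surface_measure :: (real ^ 'n) measure"
    by (rule sigma_finite_surface_measure)
  have meas: "(\<lambda>z. f (fst z *\<^sub>R snd z)) \<in> borel_measurable (borel \<Otimes>\<^sub>M surface_measure)"
    by measurable
  have meas': "(\<lambda>z. f (fst z *\<^sub>R snd z)) \<in> borel_measurable (radial_measure CARD('n) \<Otimes>\<^sub>M surface_measure)"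
    using meas by (simp add: polar_product)
  have inner [measurable]: "(\<lambda>r. \<integral>\<^sup>+s. f (r *\<^sub>R s) \<partial>surface_measure) \<in> borel_measurable borel"
    using borel_measurable_nn_integral_fst[OF meas] by simp
  have "(\<integral>\<^sup>+x. f x \<partial>lborel) = (\<integral>\<^sup>+x. f x * indicator (- {0}) x \<partial>lborel)"
    by (rule nn_integral_cong_AE, rule AE_mp[OF AE_lborel_singleton[of 0]], rule AE_I2) auto
  also have "\<dots> = (\<integral>\<^sup>+x. f x \<partial>restrict_space lborel (- {0}))"
    by (subst nn_integral_restrict_space) auto
  also have "\<dots> = (\<integral>\<^sup>+x. f (fst (norm x, x /\<^sub>R norm x) *\<^sub>R snd (norm x, x /\<^sub>R norm x)) \<partial>restrict_space lborel (- {0}))"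
    by (intro nn_integral_cong) (auto simp: space_restrict_space)
  also have "\<dots> = (\<integral>\<^sup>+z. f (fst z *\<^sub>R snd z) \<partial>(radial_measure CARD('n) \<Otimes>\<^sub>M surface_measure))"
    unfolding polar_product by (subst nn_integral_distr[OF measurable_polar]) (auto simp: meas)
  also have "\<dots> = (\<integral>\<^sup>+r. (\<integral>\<^sup>+s. f (r *\<^sub>R s) \<partial>surface_measure) \<partial>radial_measure CARD('n))"
    by (subst nn_integral_fst[OF meas', symmetric]) simp
  also have "\<dots> = (\<integral>\<^sup>+r. ennreal (r ^ (CARD('n) - 1) * indicator {0<..} r) * (\<integral>\<^sup>+s. f (r *\<^sub>R s) \<partial>surface_measure) \<partial>lborel)"
    unfolding radial_measure_def by (subst nn_integral_density) auto
  also have "\<dots> = (\<integral>\<^sup>+r\<in>{0<..}. (\<integral>\<^sup>+s. f (r *\<^sub>R s) \<partial>surface_measure) * ennreal (r ^ (CARD('n) - 1)) \<partial>lborel)"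
    by (intro nn_integral_cong) (auto split: split_indicator simp: mult.commute)
  finally show ?thesis .
qed

lemma integral_polar_coordinates:
  fixes f :: "real ^ 'n \<Rightarrow> real"
  assumes f: "integrable lborel f"
  shows "(\<integral>x. f x \<partial>lborel)
    = (LINT r:{0<..}|lborel. (\<integral>s. f (r *\<^sub>R s) \<partial>surface_measure) * r ^ (CARD('n) - 1))"
proof -
  have [measurable]: "f \<in> borel_measurable borel"
    using f by auto
  interpret S: sigma_finite_measure "surface_measure :: (real ^ 'n) measure"
    by (rule sigma_finite_surface_measure)
  interpret pair_sigma_finite "radial_measure CARD('n)" "surface_measure :: (real ^ 'n) measure"
    by (intro pair_sigma_finite.intro sigma_finite_radial_measure sigma_finite_surface_measure)
  let ?g = "\<lambda>z. f (fst z *\<^sub>R snd z)"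
  let ?R = "restrict_space lborel (- {0}) :: (real ^ 'n) measure"
  have meas: "?g \<in> borel_measurable (borel \<Otimes>\<^sub>M surface_measure)"
    by measurable
  have inner [measurable]: "(\<lambda>r. \<integral>s. f (r *\<^sub>R s) \<partial>surface_measure) \<in> borel_measurable borel"
    using S.borel_measurable_lebesgue_integral[of "\<lambda>r s. f (r *\<^sub>R s)" borel] meas by (simp add: case_prod_unfold)
  have f': "integrable ?R f"
    using f by (subst integrable_restrict_space) (use integrable_mult_indicator[of "- {0}" lborel f] in auto)
  have eq: "?g (norm x, x /\<^sub>R norm x) = f x" if "x \<in> space ?R" for x
    using that by (auto simp: space_restrict_space)
  have "integrable ?R (\<lambda>x. ?g (norm x, x /\<^sub>R norm x))"
    using f' eq by (subst Bochner_Integration.integrable_cong[OF refl eq]) auto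
  then have int: "integrable (radial_measure CARD('n) \<Otimes>\<^sub>M surface_measure) ?g"
    unfolding polar_product by (subst integrable_distr_eq[OF measurable_polar]) (use meas in auto)
  have "(\<integral>x. f x \<partial>lborel) = (\<integral>x. indicator (- {0}) x *\<^sub>R f x \<partial>lborel)"
    by (rule integral_cong_AE, simp, simp, rule AE_mp[OF AE_lborel_singleton[of 0]], rule AE_I2) auto
  also have "\<dots> = (\<integral>x. f x \<partial>?R)"
    by (subst integral_restrict_space) auto
  also have "\<dots> = (\<integral>x. ?g (norm x, x /\<^sub>R norm x) \<partial>?R)"
    using eq by (intro Bochner_Integration.integral_cong) auto
  also have "\<dots> = (\<integral>z. ?g z \<partial>(radial_measure CARD('n) \<Otimes>\<^sub>M surface_measure))"
    unfolding polar_product by (subst integral_distr[OF measurable_polar]) (use meas in auto)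
  also have "\<dots> = (\<integral>r. (\<integral>s. f (r *\<^sub>R s) \<partial>surface_measure) \<partial>radial_measure CARD('n))"
    by (subst integral_fst'[OF int, symmetric]) simp
  also have "\<dots> = (\<integral>r. (r ^ (CARD('n) - 1) * indicator {0<..} r) *\<^sub>R (\<integral>s. f (r *\<^sub>R s) \<partial>surface_measure) \<partial>lborel)"
    unfolding radial_measure_def by (subst integral_density) (auto split: split_indicator)
  also have "\<dots> = (LINT r:{0<..}|lborel. (\<integral>s. f (r *\<^sub>R s) \<partial>surface_measure) * r ^ (CARD('n) - 1))"
    unfolding set_lebesgue_integral_def
    by (intro Bochner_Integration.integral_cong) (auto split: split_indicator)
  finally show ?thesis .
qed

lemma polar_measure_surface_measure: "polar_measure surface_measure"
  unfolding polar_measure_def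
  by (auto simp: sets_surface_measure nn_integral_polar_coordinates integral_polar_coordinates)

text \<open>
  Polar coordinates for the indicator of a sector recover the mass of any set of directions from
  Lebesgue measure.
\<close>

lemma polar_measure_unique:
  fixes M :: "(real ^ 'n) measure"
  assumes M: "polar_measure M"
  shows "M = surface_measure"
proof (rule measure_eqI)
  show sets: "sets M = sets surface_measure"
    using M by (simp add: polar_measure_def sets_surface_measure)
  fix A assume A: "A \<in> sets M"
  have [measurable]: "A \<in> sets borel" and As: "A \<subseteq> sphere 0 1"
    using A by (auto simp: sets in_sets_surface_measure_iff)
  have space: "space M = sphere 0 1"
    using M by (simp add: polar_measure_def)
  have [measurable]: "sector 1 A \<in> sets borel" by (rule sector_borel) simp
  have "emeasure lborel (sector 1 A) = (\<integral>\<^sup>+x. ennreal (indicator (sector 1 A) x) \<partial>lborel)"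
    by (simp add: ennreal_indicator)
  also have "\<dots> = (\<integral>\<^sup>+r\<in>{0<..}. (\<integral>\<^sup>+s. ennreal (indicator (sector 1 A) (r *\<^sub>R s)) \<partial>M) * ennreal (r ^ (CARD('n) - 1)) \<partial>lborel)"
    using M unfolding polar_measure_def by auto
  also have "\<dots> = (\<integral>\<^sup>+r. emeasure M A * (ennreal (r ^ (CARD('n) - 1) * indicator {0<..} r) * indicator {..<1} r) \<partial>lborel)"
  proof (intro nn_integral_cong)
    fix r :: real
    have "(\<integral>\<^sup>+s. ennreal (indicator (sector 1 A) (r *\<^sub>R s)) \<partial>M) = indicator {..<1} r * emeasure M A" if "0 < r"
    proof -
      have "(\<integral>\<^sup>+s. ennreal (indicator (sector 1 A) (r *\<^sub>R s)) \<partial>M) = (\<integral>\<^sup>+s. indicator {..<1} r * indicator A s \<partial>M)"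
        using that As by (intro nn_integral_cong) (auto simp: sector_def space split: split_indicator)
      then show ?thesis
        using A by (simp add: nn_integral_cmult)
    qed
    then show "(\<integral>\<^sup>+s. ennreal (indicator (sector 1 A) (r *\<^sub>R s)) \<partial>M) * ennreal (r ^ (CARD('n) - 1)) * indicator {0<..} r
      = emeasure M A * (ennreal (r ^ (CARD('n) - 1) * indicator {0<..} r) * indicator {..<1} r)"
      by (auto split: split_indicator)
  qed
  also have "\<dots> = emeasure M A * emeasure (radial_measure CARD('n)) {..<1}"
    unfolding radial_measure_def by (subst nn_integral_cmult, simp, subst emeasure_density) auto
  also have "\<dots> = emeasure M A * ennreal (1 / CARD('n))"
    by (simp add: emeasure_radial_measure)
  finally have "emeasure surface_measure A = emeasure M A * (ennreal (1 / CARD('n)) * ennreal (real CARD('n)))"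
    using A by (simp add: sets emeasure_surface_measure ennreal_of_nat_eq_real_of_nat mult_ac)
  also have "ennreal (1 / CARD('n)) * ennreal (real CARD('n)) = 1"
    by (subst ennreal_mult[symmetric]) auto
  finally show "emeasure M A = emeasure surface_measure A" by simp
qed

lemma sphere_measure_eq: "sphere_measure = surface_measure"
  unfolding sphere_measure_def
  using polar_measure_surface_measure polar_measure_unique by (rule the_equality)

lemma emeasure_surface_measure_pos: "0 < emeasure (surface_measure :: (real ^ 'n) measure) (sphere 0 1)"
proof -
  have "sector 1 (sphere 0 1) = ball 0 1 - {0 :: real ^ 'n}"
    by (auto simp: sector_def)
  moreover have "emeasure lborel (ball 0 1 - {0 :: real ^ 'n}) = emeasure lborel (ball 0 1 :: (real ^ 'n) set)"
    by (intro emeasure_Diff_null_set) auto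
  moreover have "emeasure lborel (ball 0 1 :: (real ^ 'n) set) > 0"
    using content_ball_pos[of 1 "0 :: real ^ 'n"]
    by (auto simp: measure_def enn2real_positive_iff zero_less_iff_neq_zero)
  ultimately show ?thesis
    by (subst emeasure_surface_measure) (auto simp: in_sets_surface_measure_iff ennreal_zero_less_mult_iff)
qed

section \<open>Hoelder's inequality on spheres\<close>

text \<open>
  The integral of \<open>h\<close> over the sphere of radius \<open>t\<close> with respect to the surface area of that sphere.
\<close>

definition shell_integral :: "(real ^ 'n \<Rightarrow> ennreal) \<Rightarrow> real \<Rightarrow> ennreal" where
  "shell_integral h t = ennreal (t ^ (CARD('n) - 1)) * (\<integral>\<^sup>+s. h (t *\<^sub>R s) \<partial>surface_measure)"

lemma measurable_sphere_slice [measurable]: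
  assumes [measurable]: "f \<in> borel_measurable borel"
  shows "(\<lambda>s. f (t *\<^sub>R s)) \<in> borel_measurable surface_measure"
proof -
  have "(\<lambda>s. t *\<^sub>R s) \<in> surface_measure \<rightarrow>\<^sub>M borel"
    using measurable_ident_surface_measure by measurable
  from measurable_compose[OF this assms] show ?thesis .
qed

lemma borel_measurable_shell_integral [measurable]:
  fixes h :: "real ^ 'n \<Rightarrow> ennreal"
  assumes [measurable]: "h \<in> borel_measurable borel"
  shows "shell_integral h \<in> borel_measurable borel"
proof -
  interpret sigma_finite_measure "surface_measure :: (real ^ 'n) measure"
    by (rule sigma_finite_surface_measure)
  have "(\<lambda>z. h (fst z *\<^sub>R snd z)) \<in> borel_measurable (borel \<Otimes>\<^sub>M surface_measure)"
    by measurable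
  then have [measurable]: "(\<lambda>t. \<integral>\<^sup>+s. h (t *\<^sub>R s) \<partial>surface_measure) \<in> borel_measurable borel"
    using borel_measurable_nn_integral_fst by fastforce
  show ?thesis unfolding shell_integral_def by measurable
qed

lemma nn_integral_radial_set:
  fixes h :: "real ^ 'n \<Rightarrow> ennreal"
  assumes [measurable]: "h \<in> borel_measurable borel" "A \<in> sets borel"
  shows "(\<integral>\<^sup>+x. h x * indicator A (norm x) \<partial>lborel)
    = (\<integral>\<^sup>+t. shell_integral h t * indicator (A \<inter> {0<..}) t \<partial>lborel)"
proof -
  have "(\<integral>\<^sup>+x. h x * indicator A (norm x) \<partial>lborel)
    = (\<integral>\<^sup>+t\<in>{0<..}. (\<integral>\<^sup>+s. h (t *\<^sub>R s) * indicator A (norm (t *\<^sub>R s)) \<partial>surface_measure)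
        * ennreal (t ^ (CARD('n) - 1)) \<partial>lborel)"
    by (rule nn_integral_polar_coordinates) measurable
  also have "\<dots> = (\<integral>\<^sup>+t. shell_integral h t * indicator (A \<inter> {0<..}) t \<partial>lborel)"
  proof (intro nn_integral_cong)
    fix t :: real
    have "(\<integral>\<^sup>+s. h (t *\<^sub>R s) * indicator A (norm (t *\<^sub>R s)) \<partial>surface_measure)
      = (\<integral>\<^sup>+s. h (t *\<^sub>R s) * indicator A t \<partial>surface_measure)" if "0 < t"
      using that by (intro nn_integral_cong) simp
    then show "(\<integral>\<^sup>+s. h (t *\<^sub>R s) * indicator A (norm (t *\<^sub>R s)) \<partial>surface_measure)
        * ennreal (t ^ (CARD('n) - 1)) * indicator {0<..} t = shell_integral h t * indicator (A \<inter> {0<..}) t"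
      by (auto simp: shell_integral_def nn_integral_multc mult_ac split: split_indicator)
  qed
  finally show ?thesis .
qed

text \<open>
  A null set has vanishing integral over almost every shell.
\<close>

lemma AE_shell:
  fixes P :: "real ^ 'n \<Rightarrow> bool"
  assumes "AE x in lborel. P x"
  shows "AE t in lborel. 0 < t \<longrightarrow> (AE s in surface_measure. P (t *\<^sub>R s))"
proof -
  obtain N where N: "{x. \<not> P x} \<subseteq> N" "N \<in> sets borel" "emeasure lborel N = 0"
    using AE_E[OF assms] by auto
  note [measurable] = N(2)
  have "(\<integral>\<^sup>+t. shell_integral (indicator N) t * indicator (UNIV \<inter> {0<..}) t \<partial>lborel) = 0"
    by (subst nn_integral_radial_set[symmetric]) (simp_all add: N)
  then have "AE t in lborel. shell_integral (indicator N) t * indicator (UNIV \<inter> {0<..}) t = 0"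
    by (subst (asm) nn_integral_0_iff_AE) auto
  then show ?thesis
  proof (eventually_elim, intro impI)
    fix t :: real assume t: "shell_integral (indicator N) t * indicator (UNIV \<inter> {0<..}) t = 0" "0 < t"
    then have "(\<integral>\<^sup>+s. indicator N (t *\<^sub>R s) \<partial>(surface_measure :: (real ^ 'n) measure)) = 0"
      by (auto simp: shell_integral_def)
    then have "AE s in surface_measure. indicator N (t *\<^sub>R s) = (0 :: ennreal)"
      by (subst (asm) nn_integral_0_iff_AE) auto
    then show "AE s in surface_measure. P (t *\<^sub>R s)"
      by eventually_elim (use N(1) in \<open>auto simp: indicator_eq_0_iff\<close>)
  qed
qed

lemma borel_measurable_completion_cong_AE:
  fixes f g :: "'a \<Rightarrow> ennreal"
  assumes g: "g \<in> borel_measurable M" and eq: "AE x in M. f x = g x"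
  shows "f \<in> borel_measurable (completion M)"
proof (rule measurableI)
  fix A :: "ennreal set" assume A: "A \<in> sets borel"
  show "f -` A \<inter> space (completion M) \<in> sets (completion M)"
  proof (rule completion.in_sets_AE)
    show "g -` A \<inter> space (completion M) \<in> sets (completion M)"
      using measurable_sets[OF measurable_completion[OF g] A] .
    show "AE x in completion M. x \<in> g -` A \<inter> space (completion M) \<longleftrightarrow> x \<in> f -` A \<inter> space (completion M)"
      using AE_completion[OF eq] by eventually_elim auto
  qed simp
qed simp

text \<open>
  The essential supremum of a non-measurable function is \<open>\<infinity>\<close> by definition, so passing to a function
  that is equal almost everywhere is legitimate only because the completed measure makes \<open>f\<close>
  measurable.
\<close>

lemma esssup_completion_cong_AE:
  fixes f g :: "'a \<Rightarrow> ennreal"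
  assumes g: "g \<in> borel_measurable M" and eq: "AE x in M. f x = g x"
  shows "esssup (completion M) f = esssup M g"
proof -
  have "esssup (completion M) f = esssup (completion M) g"
    by (intro esssup_AE_cong borel_measurable_completion_cong_AE[OF assms] measurable_completion g AE_completion eq)
  also have "\<dots> = esssup M g"
    using g by (simp add: esssup_eq_AE measurable_completion AE_completion_iff)
  finally show ?thesis .
qed

text \<open>
  For \<open>t > 0\<close> this is the function \<open>\<phi>\<close> of the theorem with \<open>u = v\<^sub>2 / v\<^sub>1\<close>. For \<open>p2 < p1\<close> the power of \<open>t\<close> is
  absorbed into the shell integral: \<open>t\<close> to the power \<open>n - 1\<close>, raised to \<open>(p1 - p2) / p1\<close>.
\<close>

definition shell_weight :: "real \<Rightarrow> real \<Rightarrow> (real ^ 'n \<Rightarrow> ennreal) \<Rightarrow> real \<Rightarrow> ennreal" where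
  "shell_weight p1 p2 u t =
    (if p2 < p1 then shell_integral (\<lambda>x. u x epowr (p1 * p2 / (p1 - p2))) t epowr ((p1 - p2) / p1)
     else esssup surface_measure (\<lambda>s. u (t *\<^sub>R s) epowr p1))"

text \<open>
  The essential supremum over the sphere of radius \<open>t\<close> exceeds \<open>y\<close> iff the set \<open>{u > y}\<close> meets that sphere
  in positive measure, and this measure depends measurably on \<open>t\<close> by Tonelli's theorem.
\<close>

lemma borel_measurable_esssup_slice:
  fixes u :: "real ^ 'n \<Rightarrow> ennreal"
  assumes [measurable]: "u \<in> borel_measurable borel"
  shows "(\<lambda>t. esssup surface_measure (\<lambda>s. u (t *\<^sub>R s))) \<in> borel_measurable borel"
proof (rule borel_measurableI_greater)
  fix y :: ennreal
  interpret sigma_finite_measure "surface_measure :: (real ^ 'n) measure"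
    by (rule sigma_finite_surface_measure)
  let ?m = "\<lambda>t. \<integral>\<^sup>+s. indicator {x. y < u x} (t *\<^sub>R s) \<partial>(surface_measure :: (real ^ 'n) measure)"
  have "(\<lambda>z. indicator {x. y < u x} (fst z *\<^sub>R snd z) :: ennreal) \<in> borel_measurable (borel \<Otimes>\<^sub>M surface_measure)"
    by measurable
  then have m [measurable]: "?m \<in> borel_measurable borel"
    using borel_measurable_nn_integral_fst by fastforce
  have "y < esssup surface_measure (\<lambda>s. u (t *\<^sub>R s)) \<longleftrightarrow> 0 < ?m t" for t
  proof -
    have "esssup surface_measure (\<lambda>s. u (t *\<^sub>R s)) \<le> y \<longleftrightarrow> (AE s in surface_measure. u (t *\<^sub>R s) \<le> y)"
    proof
      assume le: "esssup surface_measure (\<lambda>s. u (t *\<^sub>R s)) \<le> y"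
      show "AE s in surface_measure. u (t *\<^sub>R s) \<le> y"
        using esssup_AE[of "\<lambda>s. u (t *\<^sub>R s)" surface_measure] by eventually_elim (use le in auto)
    qed (intro esssup_I, auto)
    also have "\<dots> \<longleftrightarrow> ?m t = 0"
      by (subst nn_integral_0_iff_AE) (auto simp: indicator_eq_0_iff not_less)
    finally show ?thesis
      by (metis not_le zero_less_iff_neq_zero)
  qed
  then have "{t \<in> space borel. y < esssup surface_measure (\<lambda>s. u (t *\<^sub>R s))} = {t. 0 < ?m t}"
    by simp
  also have "\<dots> \<in> sets borel" by measurable
  finally show "{t \<in> space borel. y < esssup surface_measure (\<lambda>s. u (t *\<^sub>R s))} \<in> sets borel" .
qed

lemma borel_measurable_shell_weight [measurable]:
  assumes [measurable]: "u \<in> borel_measurable borel"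
  shows "shell_weight p1 p2 u \<in> borel_measurable borel"
  unfolding shell_weight_def
  using borel_measurable_esssup_slice[of "\<lambda>x. u x epowr p1"] by (cases "p2 < p1") simp_all

lemma phi_eq_shell_weight:
  fixes v1 v2 :: "real ^ 'n \<Rightarrow> ennreal"
  assumes p: "0 < p2" "p2 \<le> p1"
    and [measurable]: "b1 \<in> borel_measurable borel" "b2 \<in> borel_measurable borel"
    and eq: "AE x in lborel. v1 x = b1 x \<and> v2 x = b2 x"
  shows "AE t in lborel. 0 < t \<longrightarrow> phi p1 p2 v1 v2 t = shell_weight p1 p2 (\<lambda>x. inverse (b1 x) * b2 x) t"
  using AE_shell[OF eq]
proof (eventually_elim, intro impI)
  fix t :: real
  let ?v = "\<lambda>s. inverse (v1 (t *\<^sub>R s)) * v2 (t *\<^sub>R s)" and ?b = "\<lambda>s. inverse (b1 (t *\<^sub>R s)) * b2 (t *\<^sub>R s)"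
  assume *: "0 < t \<longrightarrow> (AE s in surface_measure. v1 (t *\<^sub>R s) = b1 (t *\<^sub>R s) \<and> v2 (t *\<^sub>R s) = b2 (t *\<^sub>R s))" and t: "0 < t"
  then have ae: "AE s in surface_measure. ?v s = ?b s" by auto
  show "phi p1 p2 v1 v2 t = shell_weight p1 p2 (\<lambda>x. inverse (b1 x) * b2 x) t"
  proof (cases "p2 < p1")
    case True
    let ?e = "(p1 - p2) / p1" and ?r = "p1 * p2 / (p1 - p2)"
    have e: "0 < ?e" using True p by auto
    have "(t ^ (CARD('n) - 1)) powr ?e = t powr ((real CARD('n) - 1) * (p1 - p2) / p1)"
      using t by (simp add: powr_realpow[symmetric] powr_powr of_nat_diff)
    then have "ennreal (t ^ (CARD('n) - 1)) epowr ?e = ennreal (t powr ((real CARD('n) - 1) * (p1 - p2) / p1))"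
      using t by (simp add: epowr_ennreal)
    moreover have "(\<integral>\<^sup>+s. ?v s epowr ?r \<partial>completion surface_measure) = (\<integral>\<^sup>+s. ?b s epowr ?r \<partial>surface_measure)"
      unfolding nn_integral_completion by (rule nn_integral_cong_AE) (use ae in eventually_elim, simp)
    ultimately show ?thesis
      using True e by (simp add: phi_def sphere_measure_eq shell_weight_def shell_integral_def epowr_mult mult.commute)
  next
    case False
    have "esssup (completion surface_measure) (\<lambda>s. ?v s epowr p1) = esssup surface_measure (\<lambda>s. ?b s epowr p1)"
      by (rule esssup_completion_cong_AE, measurable) (use ae in eventually_elim, simp)
    then show ?thesis
      using False by (simp add: phi_def sphere_measure_eq shell_weight_def)
  qed
qed

lemma shell_integral_mono_AE:
  assumes "AE s in surface_measure. f (t *\<^sub>R s) \<le> g (t *\<^sub>R s)"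
  shows "shell_integral f t \<le> shell_integral g t"
  unfolding shell_integral_def by (intro mult_left_mono nn_integral_mono_AE assms) auto

lemma shell_integral_cong:
  fixes f g :: "real ^ 'n \<Rightarrow> ennreal"
  assumes "\<And>x. norm x = t \<Longrightarrow> f x = g x" "0 < t"
  shows "shell_integral f t = shell_integral g t"
  unfolding shell_integral_def
  using assms by (intro arg_cong2[where f="(*)"] nn_integral_cong) auto

lemma shell_integral_cmult:
  assumes [measurable]: "f \<in> borel_measurable borel"
  shows "shell_integral (\<lambda>x. c * f x) t = c * shell_integral f t"
  unfolding shell_integral_def by (subst nn_integral_cmult) (auto simp: mult_ac)

text \<open>
  Hoelder's inequality on the sphere of radius \<open>t\<close>, with the exponents \<open>p1 / p2\<close> and \<open>p1 / (p1 - p2)\<close>, for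
  \<open>(f b1)\<close> to the power \<open>p2\<close> times \<open>(b2 / b1)\<close> to the power \<open>p2\<close>. For \<open>p1 = p2\<close> the second factor is bounded by
  its essential supremum.
\<close>

lemma shell_holder:
  fixes f b1 b2 :: "real ^ 'n \<Rightarrow> ennreal"
  assumes p: "0 < p2" "p2 \<le> p1" and t: "0 < t"
    and [measurable]: "f \<in> borel_measurable borel" "b1 \<in> borel_measurable borel" "b2 \<in> borel_measurable borel"
    and b1: "\<And>x. 0 < b1 x" "\<And>x. b1 x < \<infinity>"
  shows "shell_integral (\<lambda>x. f x epowr p2 * b2 x epowr p2) t
    \<le> shell_integral (\<lambda>x. f x epowr p1 * b1 x epowr p1) t epowr (p2 / p1)
      * shell_weight p1 p2 (\<lambda>x. inverse (b1 x) * b2 x) t"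
proof (cases "p2 < p1")
  case True
  define a where "a = p2 / p1"
  define r where "r = p1 * p2 / (p1 - p2)"
  let ?T = "ennreal (t ^ (CARD('n) - 1))"
  let ?X = "\<lambda>x. f x epowr p1 * b1 x epowr p1" and ?Y = "\<lambda>x. (inverse (b1 x) * b2 x) epowr r"
  have a: "0 < a" "a < 1" "p1 * a = p2" "r * (1 - a) = p2" "1 - a = (p1 - p2) / p1"
    using True p by (auto simp: a_def r_def field_simps)
  \<comment> \<open>The factor \<open>b1 x epowr p2\<close> cancels because \<open>b1\<close> is positive and finite.\<close>
  have "f x epowr p2 * b2 x epowr p2 = ?X x epowr a * ?Y x epowr (1 - a)" for x
  proof -
    have "?X x epowr a * ?Y x epowr (1 - a)
        = f x epowr p2 * b2 x epowr p2 * (inverse (b1 x) epowr p2 * b1 x epowr p2)"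
      using a p by (simp add: epowr_mult epowr_epowr mult_ac)
    then show ?thesis
      using p b1 by (simp add: epowr_inverse_mult)
  qed
  then have "shell_integral (\<lambda>x. f x epowr p2 * b2 x epowr p2) t
    = ?T * (\<integral>\<^sup>+s. ?X (t *\<^sub>R s) epowr a * ?Y (t *\<^sub>R s) epowr (1 - a) \<partial>surface_measure)"
    by (simp add: shell_integral_def)
  also have "\<dots> \<le> ?T * ((\<integral>\<^sup>+s. ?X (t *\<^sub>R s) \<partial>surface_measure) epowr a * (\<integral>\<^sup>+s. ?Y (t *\<^sub>R s) \<partial>surface_measure) epowr (1 - a))"
    by (intro mult_left_mono holder_epowr a) auto
  \<comment> \<open>The Jacobian is split with the same exponents, so that each factor becomes a shell integral.\<close>
  also have "\<dots> = (?T epowr a * ?T epowr (1 - a)) * ((\<integral>\<^sup>+s. ?X (t *\<^sub>R s) \<partial>surface_measure) epowr a * (\<integral>\<^sup>+s. ?Y (t *\<^sub>R s) \<partial>surface_measure) epowr (1 - a))"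
    using a(1,2) by (simp add: epowr_add)
  also have "\<dots> = shell_integral ?X t epowr a * shell_integral ?Y t epowr (1 - a)"
    using a(1,2) by (simp add: shell_integral_def epowr_mult mult_ac)
  finally show ?thesis
    using True a(5) by (simp add: shell_weight_def a_def r_def)
next
  case False
  then have [simp]: "p2 = p1" using p by simp
  let ?u = "\<lambda>x. inverse (b1 x) * b2 x"
  let ?c = "esssup surface_measure (\<lambda>s. ?u (t *\<^sub>R s) epowr p1)"
  have "AE s in surface_measure. f (t *\<^sub>R s) epowr p1 * b2 (t *\<^sub>R s) epowr p1
      \<le> ?c * (f (t *\<^sub>R s) epowr p1 * b1 (t *\<^sub>R s) epowr p1)"
    using esssup_AE[of "\<lambda>s. ?u (t *\<^sub>R s) epowr p1" surface_measure]
  proof eventually_elim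
    fix s assume le: "?u (t *\<^sub>R s) epowr p1 \<le> ?c"
    have "f (t *\<^sub>R s) epowr p1 * b2 (t *\<^sub>R s) epowr p1
      = f (t *\<^sub>R s) epowr p1 * b2 (t *\<^sub>R s) epowr p1 * (inverse (b1 (t *\<^sub>R s)) epowr p1 * b1 (t *\<^sub>R s) epowr p1)"
      using p b1 by (simp add: epowr_inverse_mult)
    also have "\<dots> = ?u (t *\<^sub>R s) epowr p1 * (f (t *\<^sub>R s) epowr p1 * b1 (t *\<^sub>R s) epowr p1)"
      using p by (simp add: epowr_mult mult_ac)
    also have "\<dots> \<le> ?c * (f (t *\<^sub>R s) epowr p1 * b1 (t *\<^sub>R s) epowr p1)"
      using le by (rule mult_right_mono) simp
    finally show "f (t *\<^sub>R s) epowr p1 * b2 (t *\<^sub>R s) epowr p1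
      \<le> ?c * (f (t *\<^sub>R s) epowr p1 * b1 (t *\<^sub>R s) epowr p1)" .
  qed
  then have "shell_integral (\<lambda>x. f x epowr p1 * b2 x epowr p1) t
    \<le> shell_integral (\<lambda>x. ?c * (f x epowr p1 * b1 x epowr p1)) t"
    by (rule shell_integral_mono_AE)
  also have "\<dots> = ?c * shell_integral (\<lambda>x. f x epowr p1 * b1 x epowr p1) t"
    by (rule shell_integral_cmult) measurable
  finally show ?thesis
    using p by (simp add: shell_weight_def mult.commute[of _ ?c])
qed

section \<open>Sharpness of Hoelder's inequality on spheres\<close>

lemma ennreal_inverse_mult_le_1: "inverse x * x \<le> (1 :: ennreal)"
  by (cases "x = 0 \<or> x = top")
     (auto simp: ennreal_divide_self divide_ennreal_def[symmetric] mult.commute less_top zero_less_iff_neq_zero)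

lemma ennreal_inverse_mult_eq_1: "0 < x \<Longrightarrow> x < top \<Longrightarrow> inverse x * x = (1 :: ennreal)"
  using ennreal_divide_self[of x] by (simp add: divide_ennreal_def mult.commute)

lemma epowr_inverse_mult_self:
  assumes "0 < a" "a < 1" "x < top"
  shows "inverse x epowr a * x = x epowr (1 - a)"
proof (cases "x = 0")
  case False
  then have x: "0 < x" by (simp add: zero_less_iff_neq_zero)
  have "inverse x epowr a * x = inverse x epowr a * (x epowr a * x epowr (1 - a))"
    using assms by (simp add: epowr_add)
  also have "\<dots> = (inverse x epowr a * x epowr a) * x epowr (1 - a)"
    by (simp add: mult_ac)
  also have "\<dots> = x epowr (1 - a)"
    using assms x by (subst epowr_inverse_mult) auto
  finally show ?thesis .
qed simp

lemma shell_integral_finite: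
  fixes h :: "real ^ 'n \<Rightarrow> ennreal"
  assumes "\<And>x. h x \<le> c" "c < \<infinity>"
  shows "shell_integral h t < \<infinity>"
proof -
  have "(\<integral>\<^sup>+s. h (t *\<^sub>R s) \<partial>surface_measure) \<le> (\<integral>\<^sup>+s. c \<partial>(surface_measure :: (real ^ 'n) measure))"
    by (intro nn_integral_mono assms)
  also have "\<dots> < \<infinity>"
    using assms(2) finite_measure.emeasure_finite[OF finite_surface_measure, of "sphere 0 1 :: (real ^ 'n) set"]
    by (auto simp: ennreal_mult_less_top less_top)
  finally show ?thesis
    by (auto simp: shell_integral_def ennreal_mult_less_top)
qed

text \<open>
  An increasing sequence with supremum \<open>y\<close> whose terms are strictly below \<open>y\<close> if \<open>y > 0\<close>. It depends
  measurably on \<open>y\<close>.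
\<close>

lemma SUP_approx_below:
  fixes y :: ennreal
  shows "(SUP k::nat. if y = \<infinity> then of_nat k else ennreal (real k / real (Suc k)) * y) = y"
proof (cases "y = \<infinity>")
  case True
  then show ?thesis by (simp add: ennreal_SUP_of_nat_eq_top)
next
  case False
  have "incseq (\<lambda>k. ennreal (real k / real (Suc k)))"
    by (auto simp: incseq_def divide_simps algebra_simps intro!: ennreal_leI)
  moreover have "(\<lambda>k. ennreal (real k / real (Suc k))) \<longlonglongrightarrow> ennreal 1"
    using LIMSEQ_n_over_Suc_n by (intro tendsto_ennrealI) auto
  ultimately have "(SUP k. ennreal (real k / real (Suc k))) = 1"
    using LIMSEQ_SUP LIMSEQ_unique by fastforce
  then show ?thesis
    using False by (simp add: SUP_mult_right_ennreal[symmetric])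
qed

text \<open>
  Equality in Hoelder's inequality holds if the \<open>p1\<close>-th power of \<open>F b1\<close> is proportional to
  \<open>u = b2 / b1\<close> raised to \<open>r = p1 p2 / (p1 - p2)\<close>. The integral of this power may be infinite on some
  spheres; therefore \<open>u\<close> is truncated at height \<open>k\<close>, which makes the shell integral \<open>N k\<close> of the truncated
  power \<open>J k\<close> finite. Dividing by \<open>N k\<close> normalises \<open>F k\<close>.
\<close>

lemma extremal_family_less:
  fixes b1 b2 :: "real ^ 'n \<Rightarrow> ennreal"
  assumes p: "0 < p2" "p2 < p1"
    and [measurable]: "b1 \<in> borel_measurable borel" "b2 \<in> borel_measurable borel"
    and b1: "\<And>x. 0 < b1 x" "\<And>x. b1 x < \<infinity>" and b2: "\<And>x. b2 x < \<infinity>"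
  obtains F :: "nat \<Rightarrow> real ^ 'n \<Rightarrow> ennreal" and c :: "nat \<Rightarrow> real \<Rightarrow> ennreal"
  where "\<And>k. F k \<in> borel_measurable borel" "\<And>k. c k \<in> borel_measurable borel"
    "\<And>t. incseq (\<lambda>k. c k t)"
    "\<And>t. 0 < t \<Longrightarrow> (SUP k. c k t) = shell_weight p1 p2 (\<lambda>x. inverse (b1 x) * b2 x) t"
    "\<And>k t. 0 < t \<Longrightarrow> shell_integral (\<lambda>x. F k x epowr p1 * b1 x epowr p1) t \<le> 1"
    "\<And>k t. 0 < t \<Longrightarrow> c k t \<le> shell_integral (\<lambda>x. F k x epowr p2 * b2 x epowr p2) t"
proof -
  define u where "u x = inverse (b1 x) * b2 x" for x
  define a where "a = p2 / p1"
  define r where "r = p1 * p2 / (p1 - p2)"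
  define J where "J k x = u x epowr r * indicator {x. u x \<le> of_nat k} x" for k :: nat and x
  define N where "N k = shell_integral (J k)" for k
  define F where "F k x = inverse (b1 x) * inverse (N k (norm x)) epowr (1 / p1) * J k x epowr (1 / p1)" for k x
  define c where "c k t = N k t epowr (1 - a)" for k t
  have a: "0 < a" "a < 1" "p1 * a = p2" "r * (1 - a) = p2" "1 - a = (p1 - p2) / p1" "1 / p1 * p2 = a"
    "p2 + r * a = r" and r: "0 < r" and p1: "0 < p1"
    using p by (auto simp: a_def r_def field_simps)
  have u_fin: "u x < \<infinity>" for x
    using b1(1)[of x] b2[of x]
    by (auto simp: u_def ennreal_mult_eq_top_iff less_top[symmetric])
  have [measurable]: "u \<in> borel_measurable borel" unfolding u_def by measurable
  have [measurable]: "J k \<in> borel_measurable borel" for k unfolding J_def by measurable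
  have [measurable]: "N k \<in> borel_measurable borel" for k unfolding N_def by measurable
  have F_meas: "F k \<in> borel_measurable borel" for k unfolding F_def by measurable
  have c_meas: "c k \<in> borel_measurable borel" for k unfolding c_def by measurable
  have N_fin: "N k t < \<infinity>" for k t
    unfolding N_def
  proof (rule shell_integral_finite)
    show "J k x \<le> of_nat k epowr r" for x
      using r by (auto simp: J_def epowr_mono split: split_indicator)
    show "of_nat k epowr r < \<infinity>"
      by (simp add: epowr_def less_top[symmetric])
  qed
  have J_mono: "incseq (\<lambda>k. J k x)" for x
    by (auto simp: J_def incseq_def split: split_indicator intro: order_trans)
  have J_SUP: "(SUP k. J k x) = u x epowr r" for x
  proof (rule antisym)
    obtain k :: nat where "u x \<le> of_nat k"
      using u_fin[of x] ennreal_Ex_less_of_nat[of "u x"] by (auto intro: less_imp_le)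
    then have "u x epowr r = J k x" by (simp add: J_def)
    also have "\<dots> \<le> (SUP k. J k x)" by (rule SUP_upper) simp
    finally show "u x epowr r \<le> (SUP k. J k x)" .
  qed (auto simp: J_def intro!: SUP_least split: split_indicator)
  have N_mono: "incseq (\<lambda>k. N k t)" for t
    unfolding N_def incseq_def using J_mono
    by (auto intro!: shell_integral_mono_AE simp: incseq_def)
  have c_mono: "incseq (\<lambda>k. c k t)" for t
    using N_mono[of t] a by (auto simp: c_def incseq_def intro!: epowr_mono)
  have N_SUP: "(SUP k. N k t) = shell_integral (\<lambda>x. u x epowr r) t" for t
    unfolding N_def shell_integral_def
  proof (subst SUP_mult_left_ennreal[symmetric], subst nn_integral_monotone_convergence_SUP[symmetric])
    show "incseq (\<lambda>k s. J k (t *\<^sub>R s))"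
      using J_mono by (auto simp: incseq_def le_fun_def)
  qed (auto simp: J_SUP)
  have c_SUP: "(SUP k. c k t) = shell_weight p1 p2 u t" for t
    using p a N_SUP[of t] by (simp add: c_def epowr_SUP[symmetric] shell_weight_def r_def)
  \<comment> \<open>Only an upper bound: on spheres with \<open>N k t = 0\<close> the shell integral is \<open>\<infinity> * 0 = 0\<close>.\<close>
  have F1: "shell_integral (\<lambda>x. F k x epowr p1 * b1 x epowr p1) t \<le> 1" if t: "0 < t" for k t
  proof -
    have "shell_integral (\<lambda>x. F k x epowr p1 * b1 x epowr p1) t
        = shell_integral (\<lambda>x. inverse (N k t) * J k x) t"
    proof (rule shell_integral_cong[OF _ t])
      fix x :: "real ^ 'n" assume "norm x = t"
      then have "F k x epowr p1 * b1 x epowr p1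
          = inverse (N k t) * J k x * (inverse (b1 x) epowr p1 * b1 x epowr p1)"
        using p1 by (simp add: F_def epowr_mult epowr_epowr mult_ac)
      then show "F k x epowr p1 * b1 x epowr p1 = inverse (N k t) * J k x"
        using p1 b1 by (simp add: epowr_inverse_mult)
    qed
    also have "\<dots> = inverse (N k t) * N k t"
      by (simp add: shell_integral_cmult N_def)
    also have "\<dots> \<le> 1" by (rule ennreal_inverse_mult_le_1)
    finally show ?thesis .
  qed
  have F2: "c k t \<le> shell_integral (\<lambda>x. F k x epowr p2 * b2 x epowr p2) t" if t: "0 < t" for k t
  proof -
    have "shell_integral (\<lambda>x. F k x epowr p2 * b2 x epowr p2) t
        = shell_integral (\<lambda>x. inverse (N k t) epowr a * J k x) t"
    proof (rule shell_integral_cong[OF _ t])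
      fix x :: "real ^ 'n" assume x: "norm x = t"
      \<comment> \<open>The exponents match: \<open>p2 + r p2 / p1 = r\<close>.\<close>
      have "u x epowr p2 * J k x epowr a = J k x"
        using p r a(1,7) epowr_add[of p2 "r * a" "u x"]
        by (auto simp: J_def epowr_epowr split: split_indicator)
      moreover have "F k x epowr p2 * b2 x epowr p2
          = inverse (N k t) epowr a * (u x epowr p2 * J k x epowr a)"
        using p x a(6) by (simp add: F_def u_def epowr_mult epowr_epowr mult_ac)
      ultimately show "F k x epowr p2 * b2 x epowr p2 = inverse (N k t) epowr a * J k x"
        by simp
    qed
    also have "\<dots> = inverse (N k t) epowr a * N k t"
      by (simp add: shell_integral_cmult N_def)
    also have "\<dots> = c k t"
      using a N_fin by (simp add: c_def epowr_inverse_mult_self)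
    finally show ?thesis by simp
  qed
  show thesis
    using that[of F c] F_meas c_meas c_mono c_SUP F1 F2 unfolding u_def by blast
qed

text \<open>
  For equal exponents the constant in Hoelder's inequality is an essential supremum, approached by
  functions that live where \<open>u\<close>, the \<open>p\<close>-th power of \<open>b2 / b1\<close>, exceeds a level \<open>c k\<close> below it. Since the level is
  strictly below the essential supremum \<open>w\<close>, this set has positive measure on every sphere, so that its
  indicator \<open>J k\<close> can be normalised by its shell integral \<open>N k\<close>.
\<close>

lemma extremal_family_eq:
  fixes b1 b2 :: "real ^ 'n \<Rightarrow> ennreal"
  assumes p: "0 < p"
    and [measurable]: "b1 \<in> borel_measurable borel" "b2 \<in> borel_measurable borel"
    and b1: "\<And>x. 0 < b1 x" "\<And>x. b1 x < \<infinity>" and b2: "\<And>x. 0 < b2 x"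
  obtains F :: "nat \<Rightarrow> real ^ 'n \<Rightarrow> ennreal" and c :: "nat \<Rightarrow> real \<Rightarrow> ennreal"
  where "\<And>k. F k \<in> borel_measurable borel" "\<And>k. c k \<in> borel_measurable borel"
    "\<And>t. incseq (\<lambda>k. c k t)"
    "\<And>t. 0 < t \<Longrightarrow> (SUP k. c k t) = shell_weight p p (\<lambda>x. inverse (b1 x) * b2 x) t"
    "\<And>k t. 0 < t \<Longrightarrow> shell_integral (\<lambda>x. F k x epowr p * b1 x epowr p) t \<le> 1"
    "\<And>k t. 0 < t \<Longrightarrow> c k t \<le> shell_integral (\<lambda>x. F k x epowr p * b2 x epowr p) t"
proof -
  define u where "u x = (inverse (b1 x) * b2 x) epowr p" for x
  define w where "w = shell_weight p p (\<lambda>x. inverse (b1 x) * b2 x)"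
  define c where "c k t = (if w t = \<infinity> then of_nat k else ennreal (real k / real (Suc k)) * w t)" for k t
  define J :: "nat \<Rightarrow> real ^ 'n \<Rightarrow> ennreal" where "J k = indicator {x. c k (norm x) < u x}" for k
  define N where "N k = shell_integral (J k)" for k
  define F where "F k x = inverse (b1 x) * inverse (N k (norm x)) epowr (1 / p) * J k x" for k x
  have [measurable]: "u \<in> borel_measurable borel" unfolding u_def by measurable
  have [measurable]: "w \<in> borel_measurable borel" unfolding w_def by measurable
  have [measurable]: "c k \<in> borel_measurable borel" for k unfolding c_def by measurable
  have [measurable]: "J k \<in> borel_measurable borel" for k unfolding J_def by measurable
  have [measurable]: "N k \<in> borel_measurable borel" for k unfolding N_def by measurable
  have F_meas: "F k \<in> borel_measurable borel" for k unfolding F_def by measurable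
  have w_eq: "w t = esssup surface_measure (\<lambda>s. u (t *\<^sub>R s))" for t
    by (simp add: w_def u_def shell_weight_def)
  have u_pos: "0 < u x" for x
    using b1 b2 by (auto simp: u_def zero_less_iff_neq_zero epowr_eq_0_iff less_top[symmetric] dest: less_imp_neq)
  have J_idem: "J k x epowr p = J k x" for k x
    by (simp add: J_def epowr_def split: split_indicator)
  have c_mono: "incseq (\<lambda>k. c k t)" for t
  proof -
    have "ennreal (real m / real (Suc m)) \<le> ennreal (real n / real (Suc n))" if "m \<le> n" for m n
      using that by (intro ennreal_leI) (simp add: divide_simps algebra_simps)
    then show ?thesis
      unfolding c_def incseq_def by (auto intro!: mult_right_mono)
  qed
  have c_SUP: "(SUP k. c k t) = w t" for t
    unfolding c_def by (rule SUP_approx_below)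
  have w_pos: "0 < w t" for t
  proof (rule ccontr)
    assume "\<not> 0 < w t"
    then have "w t = 0" by simp
    then have "AE s in (surface_measure :: (real ^ 'n) measure). u (t *\<^sub>R s) \<le> 0"
      using esssup_AE[of "\<lambda>s. u (t *\<^sub>R s)" surface_measure] by (simp add: w_eq)
    then have "AE s in (surface_measure :: (real ^ 'n) measure). False"
      by eventually_elim (use u_pos in \<open>simp add: not_le[symmetric]\<close>)
    then have "emeasure (surface_measure :: (real ^ 'n) measure) (space surface_measure) = 0"
      unfolding ae_filter_eq_bot_iff[symmetric] trivial_limit_def .
    then show False using emeasure_surface_measure_pos[where 'n='n] by simp
  qed
  have c_less: "c k t < w t" for k t
  proof (cases "w t = \<infinity>")
    case True
    then show ?thesis by (simp add: c_def less_top[symmetric])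
  next
    case False
    then obtain y where y: "w t = ennreal y" "0 < y"
      using w_pos[of t] by (cases "w t") auto
    then show ?thesis
      by (auto simp: c_def ennreal_mult[symmetric] ennreal_less_iff divide_simps)
  qed
  have N_fin: "N k t < \<infinity>" for k t
    unfolding N_def by (rule shell_integral_finite[of _ 1]) (auto simp: J_def split: split_indicator)
  have N_pos: "0 < N k t" if t: "0 < t" for k t
  proof -
    have "emeasure surface_measure {s \<in> space surface_measure. c k t < u (t *\<^sub>R s)} > 0"
      using c_less[of k t] unfolding w_eq by (intro esssup_pos_measure) auto
    also have "emeasure surface_measure {s \<in> space surface_measure. c k t < u (t *\<^sub>R s)}
        = (\<integral>\<^sup>+s. indicator {s \<in> space surface_measure. c k t < u (t *\<^sub>R s)} s \<partial>surface_measure)"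
      by (rule nn_integral_indicator[symmetric]) measurable
    also have "\<dots> = (\<integral>\<^sup>+s. J k (t *\<^sub>R s) \<partial>surface_measure)"
      using t by (intro nn_integral_cong) (auto simp: J_def split: split_indicator)
    finally show ?thesis
      using t by (simp add: N_def shell_integral_def ennreal_zero_less_mult_iff)
  qed
  have F1: "shell_integral (\<lambda>x. F k x epowr p * b1 x epowr p) t \<le> 1" if t: "0 < t" for k t
  proof -
    have "shell_integral (\<lambda>x. F k x epowr p * b1 x epowr p) t
        = shell_integral (\<lambda>x. inverse (N k t) * J k x) t"
    proof (rule shell_integral_cong[OF _ t])
      fix x :: "real ^ 'n" assume "norm x = t"
      then have "F k x epowr p * b1 x epowr p
          = inverse (N k t) * J k x * (inverse (b1 x) epowr p * b1 x epowr p)"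
        using p by (simp add: F_def epowr_mult epowr_epowr J_idem mult_ac)
      then show "F k x epowr p * b1 x epowr p = inverse (N k t) * J k x"
        using p b1 by (simp add: epowr_inverse_mult)
    qed
    also have "\<dots> = inverse (N k t) * N k t"
      by (simp add: shell_integral_cmult N_def)
    also have "\<dots> \<le> 1" by (rule ennreal_inverse_mult_le_1)
    finally show ?thesis .
  qed
  have F2: "c k t \<le> shell_integral (\<lambda>x. F k x epowr p * b2 x epowr p) t" if t: "0 < t" for k t
  proof -
    have "c k t = c k t * inverse (N k t) * N k t"
      using N_pos[OF t] N_fin by (simp add: ennreal_inverse_mult_eq_1 mult.assoc)
    also have "\<dots> = shell_integral (\<lambda>x. c k t * inverse (N k t) * J k x) t"
      by (simp add: shell_integral_cmult N_def)
    also have "\<dots> \<le> shell_integral (\<lambda>x. F k x epowr p * b2 x epowr p) t"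
    proof (rule shell_integral_mono_AE, rule AE_I2)
      fix s :: "real ^ 'n" assume s: "s \<in> space surface_measure"
      let ?x = "t *\<^sub>R s"
      have "F k ?x epowr p * b2 ?x epowr p = u ?x * (inverse (N k t) * J k ?x)"
        using p s t by (simp add: F_def u_def epowr_mult epowr_epowr J_idem mult_ac)
      moreover have "c k t * (inverse (N k t) * J k ?x) \<le> u ?x * (inverse (N k t) * J k ?x)"
        using s t by (auto simp: J_def split: split_indicator intro!: mult_right_mono)
      ultimately show "c k t * inverse (N k t) * J k ?x \<le> F k ?x epowr p * b2 ?x epowr p"
        by (simp add: mult.assoc)
    qed
    finally show ?thesis .
  qed
  show thesis
  proof (rule that[of F c])
    show "(SUP k. c k t) = shell_weight p p (\<lambda>x. inverse (b1 x) * b2 x) t" for t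
      using c_SUP[of t] by (simp add: w_def)
  qed (use F_meas c_mono F1 F2 in auto)
qed

text \<open>
  The sharpness of \<open>shell_holder\<close> on all spheres at once: on each sphere the functions \<open>F k\<close> have norm at
  most \<open>1\<close> on the right-hand side, while the left-hand side comes arbitrarily close to the bound.
\<close>

lemma extremal_family:
  fixes b1 b2 :: "real ^ 'n \<Rightarrow> ennreal"
  assumes p: "0 < p2" "p2 \<le> p1"
    and b: "b1 \<in> borel_measurable borel" "b2 \<in> borel_measurable borel"
      "\<And>x. 0 < b1 x" "\<And>x. b1 x < \<infinity>" "\<And>x. 0 < b2 x" "\<And>x. b2 x < \<infinity>"
  obtains F :: "nat \<Rightarrow> real ^ 'n \<Rightarrow> ennreal" and c :: "nat \<Rightarrow> real \<Rightarrow> ennreal"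
  where "\<And>k. F k \<in> borel_measurable borel" "\<And>k. c k \<in> borel_measurable borel"
    "\<And>t. incseq (\<lambda>k. c k t)"
    "\<And>t. 0 < t \<Longrightarrow> (SUP k. c k t) = shell_weight p1 p2 (\<lambda>x. inverse (b1 x) * b2 x) t"
    "\<And>k t. 0 < t \<Longrightarrow> shell_integral (\<lambda>x. F k x epowr p1 * b1 x epowr p1) t \<le> 1"
    "\<And>k t. 0 < t \<Longrightarrow> c k t \<le> shell_integral (\<lambda>x. F k x epowr p2 * b2 x epowr p2) t"
proof (cases "p2 < p1")
  case True
  show thesis
  proof (rule extremal_family_less[OF p(1) True b(1,2,3,4,6)], goal_cases)
    case (1 F c)
    show thesis by (rule that[OF 1])
  qed
next
  case False
  with p have eq: "p2 = p1" and p1: "0 < p1" by auto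
  show thesis
  proof (rule extremal_family_eq[OF p1 b(1-5)], goal_cases)
    case (1 F c)
    show thesis by (rule that[unfolded eq, OF 1])
  qed
qed

section \<open>Reduction to the half-line\<close>

text \<open>
  The expression on either side of both inequalities, as a functional of the density \<open>G\<close> of the mass along
  the radius: \<open>I t\<close> is \<open>(0, t)\<close> on the left and \<open>(t, \<infinity>)\<close> on the right.
\<close>

definition hardy_norm ::
  "(real \<Rightarrow> real set) \<Rightarrow> real \<Rightarrow> real \<Rightarrow> (real \<Rightarrow> ennreal) \<Rightarrow> (real \<Rightarrow> ennreal) \<Rightarrow> ennreal" where
  "hardy_norm I p q w G =
    (\<integral>\<^sup>+t. (\<integral>\<^sup>+s. G s * indicator (I t) s \<partial>lborel) epowr (q / p) * w t epowr q
       \<partial>lebesgue_on {0<..}) epowr (1 / q)"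

lemma hardy_norm_mono:
  assumes "0 < p" "0 < q" and I: "\<And>t. 0 < t \<Longrightarrow> I t \<subseteq> {0<..}"
    and "AE s in lborel. 0 < s \<longrightarrow> G s \<le> H s"
  shows "hardy_norm I p q w G \<le> hardy_norm I p q w H"
proof -
  have "(\<integral>\<^sup>+s. G s * indicator (I t) s \<partial>lborel) \<le> (\<integral>\<^sup>+s. H s * indicator (I t) s \<partial>lborel)" if "0 < t" for t
    using assms(4) I[OF that] by (intro nn_integral_mono_AE) (auto split: split_indicator)
  then show ?thesis
    unfolding hardy_norm_def using assms(1,2)
    by (intro epowr_mono, simp, intro nn_integral_mono, intro mult_right_mono epowr_mono) auto
qed

text \<open>
  Monotone convergence in the inner and in the outer integral.
\<close>

lemma hardy_norm_SUP:
  fixes G :: "nat \<Rightarrow> real \<Rightarrow> ennreal"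
  assumes pq: "0 < p" "0 < q"
    and G [measurable]: "\<And>k. G k \<in> borel_measurable borel" and inc: "\<And>s. incseq (\<lambda>k. G k s)"
    and w [measurable]: "w \<in> borel_measurable (lebesgue_on {0<..})"
  shows "hardy_norm (\<lambda>t. {0<..<t}) p q w (\<lambda>s. SUP k. G k s)
    = (SUP k. hardy_norm (\<lambda>t. {0<..<t}) p q w (G k))"
proof -
  let ?I = "\<lambda>k t. \<integral>\<^sup>+s. G k s * indicator {0<..<t} s \<partial>lborel"
  have "(\<lambda>(t, s). G k s * indicator {z. 0 < snd z \<and> snd z < fst z} (t, s)) \<in> borel_measurable (borel \<Otimes>\<^sub>M lborel)" for k
    by measurable
  then have "(\<lambda>t. \<integral>\<^sup>+s. G k s * indicator {z. 0 < snd z \<and> snd z < fst z} (t, s) \<partial>lborel) \<in> borel_measurable borel" for k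
    by (rule lborel.borel_measurable_nn_integral)
  then have "?I k \<in> borel_measurable borel" for k
    by (rule measurable_cong[THEN iffD1, rotated]) (auto intro!: nn_integral_cong split: split_indicator)
  then have [measurable]: "?I k \<in> borel_measurable (lebesgue_on {0<..})" for k
    by (intro measurable_restrict_space1 measurable_completion) simp
  have I_mono: "k \<le> l \<Longrightarrow> ?I k t \<le> ?I l t" for k l t
    using inc by (intro nn_integral_mono mult_right_mono) (auto simp: incseq_def)
  have I_SUP: "(\<integral>\<^sup>+s. (SUP k. G k s) * indicator {0<..<t} s \<partial>lborel) = (SUP k. ?I k t)" for t
    using inc by (subst SUP_mult_right_ennreal, subst nn_integral_monotone_convergence_SUP)
      (auto simp: incseq_def le_fun_def intro!: mult_right_mono)
  have "(\<integral>\<^sup>+t. (SUP k. ?I k t) epowr (q / p) * w t epowr q \<partial>lebesgue_on {0<..})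
      = (\<integral>\<^sup>+t. (SUP k. ?I k t epowr (q / p) * w t epowr q) \<partial>lebesgue_on {0<..})"
    using pq by (simp add: epowr_SUP SUP_mult_right_ennreal)
  also have "\<dots> = (SUP k. \<integral>\<^sup>+t. ?I k t epowr (q / p) * w t epowr q \<partial>lebesgue_on {0<..})"
    using pq I_mono by (intro nn_integral_monotone_convergence_SUP)
      (auto simp: incseq_def le_fun_def intro!: mult_right_mono epowr_mono)
  finally show ?thesis
    using pq by (simp add: hardy_norm_def I_SUP epowr_SUP)
qed

text \<open>
  A weight may be chosen positive and finite everywhere, so that the algebra with its reciprocal needs no
  exceptional sets.
\<close>

lemma weight_borel_representative:
  fixes v :: "'a::euclidean_space \<Rightarrow> ennreal"
  assumes "weight_on UNIV v"
  obtains b where "b \<in> borel_measurable borel" "\<And>x. 0 < b x" "\<And>x. b x < \<infinity>" "AE x in lborel. v x = b x"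
proof -
  have v: "v \<in> borel_measurable (completion lborel)" and pos: "AE x in lborel. 0 < v x \<and> v x < \<infinity>"
    using assms unfolding weight_on_def lebesgue_on_UNIV_eq AE_completion_iff by auto
  obtain b where b: "b \<in> borel_measurable lborel" "AE x in lborel. v x = b x"
    using completion_ex_borel_measurable[OF v] by auto
  note [measurable] = b(1)
  let ?b = "\<lambda>x. if 0 < b x \<and> b x < \<infinity> then b x else 1"
  show thesis
  proof (rule that[of ?b])
    show "?b \<in> borel_measurable borel" by measurable
    show "AE x in lborel. v x = ?b x"
      using b(2) pos by eventually_elim auto
  qed auto
qed

lemma nn_integral_lebesgue_radial:
  fixes h h' :: "real ^ 'n \<Rightarrow> ennreal"
  assumes [measurable]: "h' \<in> borel_measurable borel" "A \<in> sets borel"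
    and eq: "AE x in lborel. h x = h' x"
  shows "(\<integral>\<^sup>+x. h x \<partial>lebesgue_on {x. norm x \<in> A})
    = (\<integral>\<^sup>+t. shell_integral h' t * indicator (A \<inter> {0<..}) t \<partial>lborel)"
proof -
  have "(\<integral>\<^sup>+x. h x \<partial>lebesgue_on {x. norm x \<in> A}) = (\<integral>\<^sup>+x. h x * indicator {x. norm x \<in> A} x \<partial>lebesgue)"
    by (subst nn_integral_restrict_space) auto
  also have "\<dots> = (\<integral>\<^sup>+x. h x * indicator {x. norm x \<in> A} x \<partial>lborel)"
    by (rule nn_integral_completion)
  also have "\<dots> = (\<integral>\<^sup>+x. h' x * indicator A (norm x) \<partial>lborel)"
    using eq by (intro nn_integral_cong_AE) (auto split: split_indicator)
  also have "\<dots> = (\<integral>\<^sup>+t. shell_integral h' t * indicator (A \<inter> {0<..}) t \<partial>lborel)"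
    by (rule nn_integral_radial_set) auto
  finally show ?thesis .
qed

lemma ineq_Rn_iff_shells:
  fixes v1 v2 :: "real ^ 'n \<Rightarrow> ennreal"
  assumes [measurable]: "b1 \<in> borel_measurable borel" "b2 \<in> borel_measurable borel"
    and v1: "AE x in lborel. v1 x = b1 x" and v2: "AE x in lborel. v2 x = b2 x"
  shows "ineq_Rn p1 p2 q1 q2 v1 v2 w1 w2 C \<longleftrightarrow>
    (\<forall>f. f \<in> borel_measurable borel \<longrightarrow>
      hardy_norm (\<lambda>t. {0<..<t}) p2 q2 w2 (shell_integral (\<lambda>x. f x epowr p2 * b2 x epowr p2))
      \<le> ennreal C * hardy_norm greaterThan p1 q1 w1 (shell_integral (\<lambda>x. f x epowr p1 * b1 x epowr p1)))"
    (is "_ \<longleftrightarrow> (\<forall>f. _ \<longrightarrow> ?L f \<le> _ * ?R f)")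
proof -
  have L: "(\<integral>\<^sup>+t. (\<integral>\<^sup>+x. f x epowr p2 * v2 x epowr p2 \<partial>lebesgue_on (ball 0 t)) epowr (q2 / p2)
        * w2 t epowr q2 \<partial>lebesgue_on {0<..}) epowr (1 / q2) = ?L g"
    and R: "(\<integral>\<^sup>+t. (\<integral>\<^sup>+x. f x epowr p1 * v1 x epowr p1 \<partial>lebesgue_on (UNIV - ball 0 t)) epowr (q1 / p1)
        * w1 t epowr q1 \<partial>lebesgue_on {0<..}) epowr (1 / q1) = ?R g"
    if [measurable]: "g \<in> borel_measurable borel" and fg: "AE x in lborel. f x = g x" for f g
  proof -
    have "(\<integral>\<^sup>+x. f x epowr p2 * v2 x epowr p2 \<partial>lebesgue_on (ball 0 t))
      = (\<integral>\<^sup>+s. shell_integral (\<lambda>x. g x epowr p2 * b2 x epowr p2) s * indicator {0<..<t} s \<partial>lborel)" for t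
    proof -
      have eqs: "ball 0 t = {x::real^'n. norm x \<in> {..<t}}" "{0<..<t} = {..<t} \<inter> {0<..}" by auto
      show ?thesis
        unfolding eqs by (rule nn_integral_lebesgue_radial) (use fg v2 in auto)
    qed
    then show "(\<integral>\<^sup>+t. (\<integral>\<^sup>+x. f x epowr p2 * v2 x epowr p2 \<partial>lebesgue_on (ball 0 t)) epowr (q2 / p2)
        * w2 t epowr q2 \<partial>lebesgue_on {0<..}) epowr (1 / q2) = ?L g"
      by (simp add: hardy_norm_def)
    have "(\<integral>\<^sup>+x. f x epowr p1 * v1 x epowr p1 \<partial>lebesgue_on (UNIV - ball 0 t))
      = (\<integral>\<^sup>+s. shell_integral (\<lambda>x. g x epowr p1 * b1 x epowr p1) s * indicator {t<..} s \<partial>lborel)"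
      if "0 < t" for t
    proof -
      have eqs: "UNIV - ball 0 t = {x::real^'n. norm x \<in> {t..}}" by auto
      have "(\<integral>\<^sup>+x. f x epowr p1 * v1 x epowr p1 \<partial>lebesgue_on (UNIV - ball 0 t))
        = (\<integral>\<^sup>+s. shell_integral (\<lambda>x. g x epowr p1 * b1 x epowr p1) s * indicator ({t..} \<inter> {0<..}) s \<partial>lborel)"
        unfolding eqs by (rule nn_integral_lebesgue_radial) (use fg v1 in auto)
      \<comment> \<open>The complement of the open ball contains its boundary sphere, which is a single, hence negligible, radius.\<close>
      also have "\<dots> = (\<integral>\<^sup>+s. shell_integral (\<lambda>x. g x epowr p1 * b1 x epowr p1) s * indicator {t<..} s \<partial>lborel)"
        using AE_lborel_singleton[of t] that
        by (intro nn_integral_cong_AE) (auto elim!: eventually_mono split: split_indicator)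
      finally show ?thesis .
    qed
    then show "(\<integral>\<^sup>+t. (\<integral>\<^sup>+x. f x epowr p1 * v1 x epowr p1 \<partial>lebesgue_on (UNIV - ball 0 t)) epowr (q1 / p1)
        * w1 t epowr q1 \<partial>lebesgue_on {0<..}) epowr (1 / q1) = ?R g"
      unfolding hardy_norm_def by (intro arg_cong2[where f="(epowr)"] nn_integral_cong) auto
  qed
  show ?thesis
    unfolding ineq_Rn_def
  proof safe
    fix f :: "real ^ 'n \<Rightarrow> ennreal"
    assume "\<forall>f. f \<in> borel_measurable lebesgue \<longrightarrow>
        (\<integral>\<^sup>+t. (\<integral>\<^sup>+x. f x epowr p2 * v2 x epowr p2 \<partial>lebesgue_on (ball 0 t)) epowr (q2 / p2)
              * w2 t epowr q2 \<partial>lebesgue_on {0<..}) epowr (1 / q2)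
        \<le> ennreal C *
        (\<integral>\<^sup>+t. (\<integral>\<^sup>+x. f x epowr p1 * v1 x epowr p1 \<partial>lebesgue_on (UNIV - ball 0 t)) epowr (q1 / p1)
              * w1 t epowr q1 \<partial>lebesgue_on {0<..}) epowr (1 / q1)"
      and f: "f \<in> borel_measurable borel"
    then show "?L f \<le> ennreal C * ?R f"
      using measurable_completion[of f lborel borel] L[OF f, of f] R[OF f, of f] by fastforce
  next
    fix f :: "real ^ 'n \<Rightarrow> ennreal"
    assume *: "\<forall>f. f \<in> borel_measurable borel \<longrightarrow> ?L f \<le> ennreal C * ?R f" and f: "f \<in> borel_measurable lebesgue"
    obtain g where g: "g \<in> borel_measurable borel" "AE x in lborel. f x = g x"
      using completion_ex_borel_measurable[OF f] by auto
    show "(\<integral>\<^sup>+t. (\<integral>\<^sup>+x. f x epowr p2 * v2 x epowr p2 \<partial>lebesgue_on (ball 0 t)) epowr (q2 / p2)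
              * w2 t epowr q2 \<partial>lebesgue_on {0<..}) epowr (1 / q2)
        \<le> ennreal C *
        (\<integral>\<^sup>+t. (\<integral>\<^sup>+x. f x epowr p1 * v1 x epowr p1 \<partial>lebesgue_on (UNIV - ball 0 t)) epowr (q1 / p1)
              * w1 t epowr q1 \<partial>lebesgue_on {0<..}) epowr (1 / q1)"
      unfolding L[OF g] R[OF g] using * g(1) by blast
  qed
qed

lemma nn_integral_lebesgue_on_cong:
  fixes h h' :: "real \<Rightarrow> ennreal"
  assumes A: "A \<in> sets borel" "A \<subseteq> {0<..}" and eq: "AE s in lborel. 0 < s \<longrightarrow> h s = h' s"
  shows "(\<integral>\<^sup>+s. h s \<partial>lebesgue_on A) = (\<integral>\<^sup>+s. h' s * indicator A s \<partial>lborel)"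
proof -
  have "(\<integral>\<^sup>+s. h s \<partial>lebesgue_on A) = (\<integral>\<^sup>+s. h s * indicator A s \<partial>lebesgue)"
    using A by (subst nn_integral_restrict_space) auto
  also have "\<dots> = (\<integral>\<^sup>+s. h s * indicator A s \<partial>lborel)"
    by (rule nn_integral_completion)
  also have "\<dots> = (\<integral>\<^sup>+s. h' s * indicator A s \<partial>lborel)"
    using eq A(2) by (intro nn_integral_cong_AE) (auto split: split_indicator)
  finally show ?thesis .
qed

lemma ineq_halfline_iff_borel:
  assumes \<phi>: "AE t in lborel. 0 < t \<longrightarrow> \<phi> t = \<psi> t"
  shows "ineq_halfline p1 p2 q1 q2 \<phi> w1 w2 C \<longleftrightarrow>
    (\<forall>g. g \<in> borel_measurable borel \<longrightarrow>
      hardy_norm (\<lambda>t. {0<..<t}) p2 q2 w2 (\<lambda>s. g s epowr p2 * \<psi> s)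
      \<le> ennreal C * hardy_norm greaterThan p1 q1 w1 (\<lambda>s. g s epowr p1))"
    (is "_ \<longleftrightarrow> (\<forall>g. _ \<longrightarrow> ?L g \<le> _ * ?R g)")
proof -
  have L: "(\<integral>\<^sup>+t. (\<integral>\<^sup>+s. f s epowr p2 * \<phi> s \<partial>lebesgue_on {0<..<t}) epowr (q2 / p2)
        * w2 t epowr q2 \<partial>lebesgue_on {0<..}) epowr (1 / q2) = ?L g"
    and R: "(\<integral>\<^sup>+t. (\<integral>\<^sup>+s. f s epowr p1 \<partial>lebesgue_on {t<..}) epowr (q1 / p1)
        * w1 t epowr q1 \<partial>lebesgue_on {0<..}) epowr (1 / q1) = ?R g"
    if fg: "AE s in lborel. 0 < s \<longrightarrow> f s = g s" for f g
  proof -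
    have "(\<integral>\<^sup>+s. f s epowr p2 * \<phi> s \<partial>lebesgue_on {0<..<t})
      = (\<integral>\<^sup>+s. g s epowr p2 * \<psi> s * indicator {0<..<t} s \<partial>lborel)" for t
      by (rule nn_integral_lebesgue_on_cong) (use fg \<phi> in auto)
    then show "(\<integral>\<^sup>+t. (\<integral>\<^sup>+s. f s epowr p2 * \<phi> s \<partial>lebesgue_on {0<..<t}) epowr (q2 / p2)
        * w2 t epowr q2 \<partial>lebesgue_on {0<..}) epowr (1 / q2) = ?L g"
      by (simp add: hardy_norm_def)
    have "(\<integral>\<^sup>+s. f s epowr p1 \<partial>lebesgue_on {t<..}) = (\<integral>\<^sup>+s. g s epowr p1 * indicator {t<..} s \<partial>lborel)"
      if "0 < t" for t
      by (rule nn_integral_lebesgue_on_cong) (use fg that in auto)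
    then show "(\<integral>\<^sup>+t. (\<integral>\<^sup>+s. f s epowr p1 \<partial>lebesgue_on {t<..}) epowr (q1 / p1)
        * w1 t epowr q1 \<partial>lebesgue_on {0<..}) epowr (1 / q1) = ?R g"
      unfolding hardy_norm_def by (intro arg_cong2[where f="(epowr)"] nn_integral_cong) auto
  qed
  show ?thesis
    unfolding ineq_halfline_def
  proof safe
    fix f :: "real \<Rightarrow> ennreal"
    assume *: "\<forall>g. g \<in> borel_measurable (lebesgue_on {0<..}) \<longrightarrow>
        (\<integral>\<^sup>+t. (\<integral>\<^sup>+s. g s epowr p2 * \<phi> s \<partial>lebesgue_on {0<..<t}) epowr (q2 / p2)
              * w2 t epowr q2 \<partial>lebesgue_on {0<..}) epowr (1 / q2)
        \<le> ennreal C *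
        (\<integral>\<^sup>+t. (\<integral>\<^sup>+s. g s epowr p1 \<partial>lebesgue_on {t<..}) epowr (q1 / p1)
              * w1 t epowr q1 \<partial>lebesgue_on {0<..}) epowr (1 / q1)"
      and f: "f \<in> borel_measurable borel"
    have "f \<in> borel_measurable (lebesgue_on {0<..})"
      using f by (intro measurable_restrict_space1 measurable_completion) simp
    then show "?L f \<le> ennreal C * ?R f"
      using * L[of f f] R[of f f] by fastforce
  next
    fix f :: "real \<Rightarrow> ennreal"
    assume *: "\<forall>f. f \<in> borel_measurable borel \<longrightarrow> ?L f \<le> ennreal C * ?R f"
      and f: "f \<in> borel_measurable (lebesgue_on {0<..})"
    have "(\<lambda>s. f s * indicator {0<..} s) \<in> borel_measurable lebesgue"
      using f by (subst (asm) borel_measurable_restrict_space_iff_ennreal) auto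
    then obtain g where g: "g \<in> borel_measurable borel" "AE s in lborel. f s * indicator {0<..} s = g s"
      using completion_ex_borel_measurable by fastforce
    then have fg: "AE s in lborel. 0 < s \<longrightarrow> f s = g s"
      by (auto elim!: eventually_mono)
    show "(\<integral>\<^sup>+t. (\<integral>\<^sup>+s. f s epowr p2 * \<phi> s \<partial>lebesgue_on {0<..<t}) epowr (q2 / p2)
              * w2 t epowr q2 \<partial>lebesgue_on {0<..}) epowr (1 / q2)
        \<le> ennreal C *
        (\<integral>\<^sup>+t. (\<integral>\<^sup>+s. f s epowr p1 \<partial>lebesgue_on {t<..}) epowr (q1 / p1)
              * w1 t epowr q1 \<partial>lebesgue_on {0<..}) epowr (1 / q1)"
      unfolding L[OF fg] R[OF fg] using * g(1) by blast
  qed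
qed

text \<open>
  The two inequalities hold with the same constants: one implication is Hoelder's inequality on the
  spheres, the other its sharpness.
\<close>

lemma ineq_Rn_iff_ineq_halfline:
  fixes v1 v2 :: "real ^ 'n \<Rightarrow> ennreal"
  assumes p: "0 < p2" "p2 \<le> p1" and q: "0 < q1" "0 < q2"
    and v: "weight_on UNIV v1" "weight_on UNIV v2" and w: "weight_on {0<..} w2"
  shows "ineq_Rn p1 p2 q1 q2 v1 v2 w1 w2 C \<longleftrightarrow> ineq_halfline p1 p2 q1 q2 (phi p1 p2 v1 v2) w1 w2 C"
proof -
  obtain b1 where b1 [measurable]: "b1 \<in> borel_measurable borel"
    and b1': "\<And>x. 0 < b1 x" "\<And>x. b1 x < \<infinity>" and v1: "AE x in lborel. v1 x = b1 x"
    using weight_borel_representative[OF v(1)] by blast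
  obtain b2 where b2 [measurable]: "b2 \<in> borel_measurable borel"
    and b2': "\<And>x. 0 < b2 x" "\<And>x. b2 x < \<infinity>" and v2: "AE x in lborel. v2 x = b2 x"
    using weight_borel_representative[OF v(2)] by blast
  define \<psi> where "\<psi> = shell_weight p1 p2 (\<lambda>x. inverse (b1 x) * b2 x)"
  let ?S1 = "\<lambda>f. shell_integral (\<lambda>x. f x epowr p1 * b1 x epowr p1)"
  let ?S2 = "\<lambda>f. shell_integral (\<lambda>x. f x epowr p2 * b2 x epowr p2)"
  let ?L = "hardy_norm (\<lambda>t. {0<..<t}) p2 q2 w2" and ?R = "hardy_norm greaterThan p1 q1 w1"
  have p1: "0 < p1" using p by simp
  have phi: "AE t in lborel. 0 < t \<longrightarrow> phi p1 p2 v1 v2 t = \<psi> t"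
    unfolding \<psi>_def using v1 v2 by (intro phi_eq_shell_weight p b1 b2) auto
  have L_mono: "?L G \<le> ?L H" if "\<And>s. 0 < s \<Longrightarrow> G s \<le> H s" for G H
    using p q that by (intro hardy_norm_mono) auto
  have R_mono: "?R G \<le> ?R H" if "\<And>s. 0 < s \<Longrightarrow> G s \<le> H s" for G H
    using p1 q that by (intro hardy_norm_mono) auto
  have "(\<forall>f. f \<in> borel_measurable borel \<longrightarrow> ?L (?S2 f) \<le> ennreal C * ?R (?S1 f)) \<longleftrightarrow>
    (\<forall>g. g \<in> borel_measurable borel \<longrightarrow> ?L (\<lambda>s. g s epowr p2 * \<psi> s) \<le> ennreal C * ?R (\<lambda>s. g s epowr p1))"
  proof safe
    fix f :: "real ^ 'n \<Rightarrow> ennreal"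
    assume H: "\<forall>g. g \<in> borel_measurable borel \<longrightarrow>
        ?L (\<lambda>s. g s epowr p2 * \<psi> s) \<le> ennreal C * ?R (\<lambda>s. g s epowr p1)"
      and [measurable]: "f \<in> borel_measurable borel"
    define g where "g s = ?S1 f s epowr (1 / p1)" for s
    have [measurable]: "g \<in> borel_measurable borel" unfolding g_def by measurable
    have g: "g s epowr p1 = ?S1 f s" "g s epowr p2 = ?S1 f s epowr (p2 / p1)" for s
      using p1 by (simp_all add: g_def epowr_epowr)
    have "?L (?S2 f) \<le> ?L (\<lambda>s. g s epowr p2 * \<psi> s)"
    proof (rule L_mono)
      fix s :: real assume "0 < s"
      then show "?S2 f s \<le> g s epowr p2 * \<psi> s"
        unfolding g \<psi>_def by (intro shell_holder p b1') auto
    qed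
    also have "\<dots> \<le> ennreal C * ?R (\<lambda>s. g s epowr p1)"
      using H by simp
    finally show "?L (?S2 f) \<le> ennreal C * ?R (?S1 f)"
      by (simp add: g)
  next
    fix g :: "real \<Rightarrow> ennreal"
    assume H: "\<forall>f. f \<in> borel_measurable borel \<longrightarrow> ?L (?S2 f) \<le> ennreal C * ?R (?S1 f)"
      and [measurable]: "g \<in> borel_measurable borel"
    \<comment> \<open>Near-extremal functions on the spheres, to be weighted by the given radial profile \<open>g\<close>.\<close>
    obtain F :: "nat \<Rightarrow> real ^ 'n \<Rightarrow> ennreal" and c :: "nat \<Rightarrow> real \<Rightarrow> ennreal"
      where F [measurable]: "\<And>k. F k \<in> borel_measurable borel"
      and c [measurable]: "\<And>k. c k \<in> borel_measurable borel" and c_mono: "\<And>t. incseq (\<lambda>k. c k t)"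
      and c_SUP: "\<And>t. 0 < t \<Longrightarrow> (SUP k. c k t) = \<psi> t"
      and F1: "\<And>k t. 0 < t \<Longrightarrow> ?S1 (F k) t \<le> 1" and F2: "\<And>k t. 0 < t \<Longrightarrow> c k t \<le> ?S2 (F k) t"
      unfolding \<psi>_def using extremal_family[OF p b1 b2 b1' b2'] by blast
    define f where "f k x = g (norm x) * F k x" for k x
    have [measurable]: "f k \<in> borel_measurable borel" for k unfolding f_def by measurable
    have S: "shell_integral (\<lambda>x. f k x epowr p * b x epowr p) t
        = g t epowr p * shell_integral (\<lambda>x. F k x epowr p * b x epowr p) t"
      if "0 < t" "0 < p" and [measurable]: "b \<in> borel_measurable borel" for k t p b
    proof -
      have "shell_integral (\<lambda>x. f k x epowr p * b x epowr p) t
        = shell_integral (\<lambda>x. g t epowr p * (F k x epowr p * b x epowr p)) t"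
        using that by (intro shell_integral_cong) (auto simp: f_def epowr_mult mult_ac)
      also have "\<dots> = g t epowr p * shell_integral (\<lambda>x. F k x epowr p * b x epowr p) t"
        by (rule shell_integral_cmult) measurable
      finally show ?thesis .
    qed
    have bound: "?L (\<lambda>s. g s epowr p2 * c k s) \<le> ennreal C * ?R (\<lambda>s. g s epowr p1)" for k
    proof -
      have "?L (\<lambda>s. g s epowr p2 * c k s) \<le> ?L (?S2 (f k))"
        using p F2 by (intro L_mono) (auto simp: S intro!: mult_left_mono)
      also have "\<dots> \<le> ennreal C * ?R (?S1 (f k))"
        using H by simp
      also have "\<dots> \<le> ennreal C * ?R (\<lambda>s. g s epowr p1)"
      proof (intro mult_left_mono R_mono)
        fix s :: real assume s: "0 < s"
        have "?S1 (f k) s \<le> g s epowr p1 * 1"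
          unfolding S[OF s p1 b1] using F1[OF s] by (rule mult_left_mono) simp
        then show "?S1 (f k) s \<le> g s epowr p1" by simp
      qed simp
      finally show ?thesis .
    qed
    have "?L (\<lambda>s. g s epowr p2 * \<psi> s) \<le> ?L (\<lambda>s. SUP k. g s epowr p2 * c k s)"
      by (rule L_mono) (simp add: c_SUP SUP_mult_left_ennreal[symmetric])
    also have "\<dots> = (SUP k. ?L (\<lambda>s. g s epowr p2 * c k s))"
      using p q w c_mono by (intro hardy_norm_SUP) (auto simp: weight_on_def incseq_def intro!: mult_left_mono)
    also have "\<dots> \<le> ennreal C * ?R (\<lambda>s. g s epowr p1)"
      by (intro SUP_least bound)
    finally show "?L (\<lambda>s. g s epowr p2 * \<psi> s) \<le> ennreal C * ?R (\<lambda>s. g s epowr p1)" .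
  qed
  then show ?thesis
    unfolding ineq_Rn_iff_shells[OF b1 b2 v1 v2] ineq_halfline_iff_borel[OF phi] .
qed

theorem theorem2p2:
  fixes p1 p2 q1 q2 :: real
    and v1 v2 :: "real ^ 'n \<Rightarrow> ennreal"
    and w1 w2 :: "real \<Rightarrow> ennreal"
  assumes "0 < p2" and "p2 \<le> p1" and "0 < q1" and "0 < q2"
    and "weight_on UNIV v1" and "weight_on UNIV v2"
    and "weight_on {0<..} w1" and "weight_on {0<..} w2"
    and "\<exists>t>0. (\<integral>\<^sup>+s. w1 s epowr q1 \<partial>lebesgue_on {0<..<t}) < \<infinity> \<and>
               (\<integral>\<^sup>+s. w2 s epowr q2 \<partial>lebesgue_on {t<..}) < \<infinity>"
  shows "((\<exists>C>0. ineq_Rn p1 p2 q1 q2 v1 v2 w1 w2 C) \<longleftrightarrow>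
          (\<exists>C>0. ineq_halfline p1 p2 q1 q2 (phi p1 p2 v1 v2) w1 w2 C)) \<and>
         best_constant (ineq_Rn p1 p2 q1 q2 v1 v2 w1 w2) =
         best_constant (ineq_halfline p1 p2 q1 q2 (phi p1 p2 v1 v2) w1 w2)"
proof -
  have "ineq_Rn p1 p2 q1 q2 v1 v2 w1 w2 = ineq_halfline p1 p2 q1 q2 (phi p1 p2 v1 v2) w1 w2"
    using assms(1-6,8) by (intro ext ineq_Rn_iff_ineq_halfline)
  then show ?thesis by simp
qed

end
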